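(* Let $0<p<\infty$. Let $\phi$ be a holomorphic self map of the open unit disk $\mathbb{D}$ and let $S_{\mu_1}$ and $S_{\mu_2}$ be two singular inner functions. Then $C_\phi(S_{\mu_1}H^p)\subseteq S_{\mu_2}H^p$ if and only if $S_{\mu_2}$ divides the singular part of $S_{\mu_1}\circ\phi$.
   Context: For a finite positive Borel measure $\mu$ on the unit circle $\mathbb{T}$, singular with respect to Lebesgue measure, $S_\mu(z)=\alpha\exp\left(-\int_{\mathbb{T}}\frac{t+z}{t-z}\,d\mu(t)\right)$ with $|\alpha|=1$; such functions are the singular inner functions. Every nonzero $f\in H^p$ factors as $f=BSg$ with $B$ a Blaschke product, $S$ a singular inner function (the singular part of $f$) and $g$ an outer function, uniquely up to unimodular constants. For $f,g\in H^\infty$ (bounded holomorphic functions on $\mathbb{D}$), "$f$ divides $g$" means $g=fh$ for some $h\in H^\infty$. $H^p$ is the Hardy space on $\mathbb{D}$, $\theta H^p=\{\theta f:f\in H^p\}$, and $C_\phi(f)=f\circ\phi$. *)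

theory Defs
  imports "HOL-Complex_Analysis.Complex_Analysis"
begin

text \<open>
  Functions on the open unit disk are represented by total functions
  \<^typ>\<open>complex \<Rightarrow> complex\<close> of which only the values on the disk matter.  Every notion below is
  therefore invariant under changing a function outside the disk; identities between functions
  are required on the disk only.
\<close>

abbreviation unit_disk :: "complex set" where
  "unit_disk \<equiv> ball 0 1"

abbreviation unit_circle :: "complex set" where
  "unit_circle \<equiv> sphere 0 1"

definition circle_borel :: "complex measure" where
  "circle_borel = restrict_space borel unit_circle"

text \<open>Lebesgue measure on the circle, normalised to total mass one.\<close>

definition circle_lebesgue :: "complex measure" where
  "circle_lebesgue = distr (uniform_measure lborel {0..<2 * pi}) circle_borel cis"

definition mutually_singular :: "'a measure \<Rightarrow> 'a measure \<Rightarrow> bool" where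
  "mutually_singular \<mu> \<nu> \<longleftrightarrow>
     (\<exists>N\<in>sets \<mu> \<inter> sets \<nu>. emeasure \<mu> (space \<mu> - N) = 0 \<and> emeasure \<nu> N = 0)"

text \<open>The zero measure is allowed; unimodular constants are singular inner functions.\<close>

definition singular_circle_measure :: "complex measure \<Rightarrow> bool" where
  "singular_circle_measure \<mu> \<longleftrightarrow>
     sets \<mu> = sets circle_borel \<and> finite_measure \<mu> \<and> mutually_singular \<mu> circle_lebesgue"

definition singular_fun :: "complex \<Rightarrow> complex measure \<Rightarrow> complex \<Rightarrow> complex" where
  "singular_fun \<alpha> \<mu> z = \<alpha> * exp (- (\<integral>t. (t + z) / (t - z) \<partial>\<mu>))"

definition singular_inner :: "(complex \<Rightarrow> complex) \<Rightarrow> bool" where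
  "singular_inner S \<longleftrightarrow>
     (\<exists>\<alpha> \<mu>. cmod \<alpha> = 1 \<and> singular_circle_measure \<mu> \<and> (\<forall>z\<in>unit_disk. S z = singular_fun \<alpha> \<mu> z))"

definition blaschke_factor :: "complex \<Rightarrow> complex \<Rightarrow> complex" where
  "blaschke_factor a z = (of_real (cmod a) / a) * ((a - z) / (1 - cnj a * z))"

text \<open>
  The nonzero zeros, repeated according to multiplicity, are enumerated by an index set \<open>J\<close> of
  naturals, which may be empty, finite or infinite; indices outside \<open>J\<close> contribute the factor 1.
\<close>

definition blaschke_product :: "(complex \<Rightarrow> complex) \<Rightarrow> bool" where
  "blaschke_product B \<longleftrightarrow>
     (\<exists>(m::nat) (J::nat set) (a::nat \<Rightarrow> complex).
        a ` J \<subseteq> unit_disk - {0} \<and>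
        (\<lambda>n. 1 - cmod (a n)) summable_on J \<and>
        (\<forall>z\<in>unit_disk. B z = z ^ m * (\<Prod>n. if n \<in> J then blaschke_factor (a n) z else 1)))"

text \<open>
  Positivity of \<open>\<psi>\<close> almost everywhere is part of the integrability of its logarithm; it is stated
  separately because \<open>ln 0 = 0\<close> here.
\<close>

definition outer_function :: "(complex \<Rightarrow> complex) \<Rightarrow> bool" where
  "outer_function g \<longleftrightarrow>
     (\<exists>(\<alpha>::complex) (\<psi>::complex \<Rightarrow> real).
        cmod \<alpha> = 1 \<and>
        \<psi> \<in> borel_measurable circle_lebesgue \<and>
        (AE t in circle_lebesgue. 0 < \<psi> t) \<and>
        integrable circle_lebesgue (\<lambda>t. ln (\<psi> t)) \<and>
        (\<forall>z\<in>unit_disk.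
           g z = \<alpha> * exp (\<integral>t. (t + z) / (t - z) * of_real (ln (\<psi> t)) \<partial>circle_lebesgue)))"

definition is_singular_part :: "(complex \<Rightarrow> complex) \<Rightarrow> (complex \<Rightarrow> complex) \<Rightarrow> bool" where
  "is_singular_part f S \<longleftrightarrow>
     singular_inner S \<and>
     (\<exists>B g. blaschke_product B \<and> outer_function g \<and> (\<forall>z\<in>unit_disk. f z = B z * S z * g z))"

text \<open>
  For nonzero \<open>f\<close> in some Hardy space the singular part exists and is unique on the disk up to a
  unimodular constant, which does not affect divisibility; one representative is chosen.
\<close>

definition singular_part :: "(complex \<Rightarrow> complex) \<Rightarrow> complex \<Rightarrow> complex" where
  "singular_part f = (SOME S. is_singular_part f S)"

definition Hardy :: "real \<Rightarrow> (complex \<Rightarrow> complex) set" where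
  "Hardy p = {f. f holomorphic_on unit_disk \<and>
     bdd_above ((\<lambda>r. \<integral>t. cmod (f (of_real r * t)) powr p \<partial>circle_lebesgue) ` {0<..<1})}"

definition Hardy_inf :: "(complex \<Rightarrow> complex) set" where
  "Hardy_inf = {f. f holomorphic_on unit_disk \<and> bounded (f ` unit_disk)}"

definition Hinf_divides :: "(complex \<Rightarrow> complex) \<Rightarrow> (complex \<Rightarrow> complex) \<Rightarrow> bool" where
  "Hinf_divides f g \<longleftrightarrow> (\<exists>h\<in>Hardy_inf. \<forall>z\<in>unit_disk. g z = f z * h z)"

text \<open>The set \<open>\<theta> H\<^sup>p\<close>.\<close>

definition mult_Hardy :: "(complex \<Rightarrow> complex) \<Rightarrow> real \<Rightarrow> (complex \<Rightarrow> complex) set" where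
  "mult_Hardy \<theta> p = {F. \<exists>f\<in>Hardy p. \<forall>z\<in>unit_disk. F z = \<theta> z * f z}"

definition composition_op ::
  "(complex \<Rightarrow> complex) \<Rightarrow> (complex \<Rightarrow> complex) \<Rightarrow> complex \<Rightarrow> complex" where
  "composition_op \<phi> f = f \<circ> \<phi>"

end

theory Submission
  imports Defs "HOL-Probability.Helly_Selection" "HOL-Real_Asymp.Real_Asymp"
begin

text \<open>
  Write \<open>m\<close> for normalised Lebesgue measure on the circle, \<open>P[\<nu>]\<close> for the Poisson integral of a
  measure \<open>\<nu>\<close>, and \<open>P[u]\<close> for that of the density \<open>u\<close>.  Since \<open>F = S\<^sub>1 \<circ> \<phi>\<close> has no zeros, the
  Blaschke factor in any factorization of \<open>F\<close> is trivial, so that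
  \<open>\<bar>F\<bar> = \<bar>S\<bar> exp P[u]\<close> with \<open>S\<close> the singular part, \<open>\<bar>S\<bar> = exp (- P[\<sigma>])\<close>, and \<open>u\<close> the logarithm of
  the boundary modulus of the outer factor.  Divisibility questions thus become comparisons of
  measures.  The tool is lemma \<open>measure_le_of_poisson_integral_le\<close>: an inequality
  \<open>P[\<mu>] \<le> P[\<nu>] + P[u] + w\<close> on the disk, in which the nonnegative error \<open>w\<close> has means at most \<open>C\<close>
  on all circles, implies \<open>\<mu> K \<le> \<nu> K + \<integral>\<^sub>K u dm + C\<close> for every compact \<open>K\<close>.

  From \<open>\<bar>F\<bar> \<le> 1\<close> one has \<open>P[u] \<le> P[\<sigma>]\<close>; as \<open>\<sigma>\<close> lives on an \<open>m\<close>-null set, \<open>u \<le> 0\<close> almost everywhere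
  and hence \<open>\<bar>F\<bar> \<le> \<bar>S\<bar>\<close> (\<open>outer_exponent_nonpos\<close>).  If \<open>S = S\<^sub>2 h\<close> with
  \<open>h\<close> bounded, then \<open>q = F / S\<^sub>2\<close> is bounded, and \<open>(S\<^sub>1 f) \<circ> \<phi> = S\<^sub>2 \<cdot> q \<cdot> (f \<circ> \<phi>)\<close>, where \<open>f \<circ> \<phi>\<close> is again in \<open>H\<^sup>p\<close> by Littlewood's subordination
  principle (\<open>littlewood_subordination\<close>).

  Conversely the inclusion, applied to \<open>S\<^sub>1\<close> itself, gives \<open>F = S\<^sub>2 f\<close> with \<open>f \<in> H\<^sup>p\<close>, that is,
  \<open>P[\<mu>\<^sub>2] = P[\<sigma>] - P[u] + ln \<bar>f\<bar>\<close>.  The logarithm grows more slowly than any power, so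
  \<open>ln \<bar>f\<bar> \<le> A + \<epsilon> \<bar>f\<bar>\<^sup>p\<close> for each \<open>\<epsilon> > 0\<close>.  On null sets the densities \<open>u\<close> and \<open>A\<close> do not
  count, and \<open>\<epsilon>\<close> is arbitrary; hence \<open>\<mu>\<^sub>2 \<le> \<sigma>\<close> on null sets, therefore everywhere because \<open>\<mu>\<^sub>2\<close> is
  singular (\<open>singular_measure_le_of_Hardy_quotient\<close>), and \<open>\<bar>S / S\<^sub>2\<bar> \<le> 1\<close>.

  That \<open>F\<close> has a singular part at all (\<open>singular_part_exists\<close>) rests on Herglotz's theorem,
  obtained here from Helly's selection theorem, and on the Lebesgue decomposition of the
  representing measure.
\<close>

section \<open>Finite measures on the circle\<close>

locale circle_measure = finite_measure M for M :: "complex measure" +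
  assumes sets_M: "sets M = sets circle_borel"
begin

lemma space_M: "space M = unit_circle"
  using sets_eq_imp_space_eq[OF sets_M] by (simp add: circle_borel_def space_restrict_space)

lemma measurable_M: "measurable M N = measurable circle_borel N"
  by (rule measurable_cong_sets[OF sets_M refl])

lemma borel_measurable_continuous [intro]:
  fixes g :: "complex \<Rightarrow> 'a::topological_space"
  assumes "continuous_on unit_circle g" shows "g \<in> borel_measurable M"
  unfolding measurable_M circle_borel_def
  using assms by (rule borel_measurable_continuous_on_restrict)

lemma integrable_continuous:
  fixes g :: "complex \<Rightarrow> 'a::{banach, second_countable_topology}"
  assumes "continuous_on unit_circle g" shows "integrable M g"
proof -
  obtain B where "\<And>t. t \<in> unit_circle \<Longrightarrow> norm (g t) \<le> B"
    using compact_imp_bounded[OF compact_continuous_image[OF assms compact_sphere]]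
    unfolding bounded_iff by blast
  then show ?thesis
    by (intro integrable_const_bound[where B = B] AE_I2 borel_measurable_continuous assms)
      (auto simp: space_M)
qed

lemma borel_set_M: "K \<in> sets borel \<Longrightarrow> K \<subseteq> unit_circle \<Longrightarrow> K \<in> sets M"
  unfolding sets_M circle_borel_def by (auto simp: sets_restrict_space)

end

lemma measurable_cis [measurable]: "cis \<in> measurable borel circle_borel"
  unfolding circle_borel_def
  by (intro measurable_restrict_space2 borel_measurable_continuous_onI continuous_on_cis continuous_on_id) auto

lemma circle_lebesgue_eq:
  "circle_lebesgue =
     distr (density lborel (\<lambda>\<theta>. ennreal (indicator {0..<2 * pi} \<theta> / (2 * pi)))) circle_borel cis"
proof -
  have "(indicator {0..<2 * pi} \<theta> :: ennreal) / ennreal (2 * pi)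
      = ennreal (indicator {0..<2 * pi} \<theta> / (2 * pi))" for \<theta> :: real
    by (subst divide_ennreal[symmetric]) (auto split: split_indicator)
  then show ?thesis
    by (simp add: circle_lebesgue_def uniform_measure_def)
qed

interpretation m: prob_space circle_lebesgue
  unfolding circle_lebesgue_def
  by (intro prob_space.prob_space_distr prob_space_uniform_measure) (auto simp: uniform_measure_def)

interpretation m: circle_measure circle_lebesgue
  by (intro circle_measure.intro circle_measure_axioms.intro m.finite_measure_axioms)
    (simp add: circle_lebesgue_def)

lemma integral_circle_lebesgue_density:
  fixes g :: "complex \<Rightarrow> 'a::{banach, second_countable_topology}"
  assumes "g \<in> borel_measurable circle_borel"
  shows "(\<integral>t. g t \<partial>circle_lebesgue) = (\<integral>\<theta>. (indicator {0..<2 * pi} \<theta> / (2 * pi)) *\<^sub>R g (cis \<theta>) \<partial>lborel)"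
  unfolding circle_lebesgue_eq
  by (subst integral_distr, use assms in measurable)+
     (subst integral_density, use assms in \<open>auto\<close>)

lemma has_integral_circle_lebesgue:
  fixes g :: "complex \<Rightarrow> complex"
  assumes "continuous_on unit_circle g"
  shows "((\<lambda>\<theta>. g (cis \<theta>)) has_integral (2 * pi * (\<integral>t. g t \<partial>circle_lebesgue))) {0..2 * pi}"
proof -
  have cont: "continuous_on UNIV (\<lambda>\<theta>. g (cis \<theta>))"
    by (intro continuous_on_compose2[OF assms]) (auto intro!: continuous_intros)
  have "(\<integral>t. g t \<partial>circle_lebesgue) = (\<integral>\<theta>. (indicator {0..<2 * pi} \<theta> / (2 * pi)) *\<^sub>R g (cis \<theta>) \<partial>lborel)"
    by (intro integral_circle_lebesgue_density) (simp add: circle_borel_def borel_measurable_continuous_on_restrict assms)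
  also have "\<dots> = (\<integral>\<theta>. (1 / (2 * pi)) *\<^sub>R (indicator {0..2 * pi} \<theta> *\<^sub>R g (cis \<theta>)) \<partial>lborel)"
  proof (rule integral_cong_AE)
    show "AE \<theta> in lborel. (indicator {0..<2 * pi} \<theta> / (2 * pi)) *\<^sub>R g (cis \<theta>) =
               (1 / (2 * pi)) *\<^sub>R indicator {0..2 * pi} \<theta> *\<^sub>R g (cis \<theta>)"
      using AE_lborel_singleton[of "2 * pi"] by eventually_elim (auto split: split_indicator)
  qed (use borel_measurable_continuous_onI[OF cont] in measurable)
  also have "\<dots> = (1 / (2 * pi)) *\<^sub>R (LINT \<theta>:{0..2 * pi}|lborel. g (cis \<theta>))"
    unfolding set_lebesgue_integral_def by (rule integral_scaleR_right)
  finally have eq: "2 * pi * (\<integral>t. g t \<partial>circle_lebesgue) = (LINT \<theta>:{0..2 * pi}|lborel. g (cis \<theta>))"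
    by (simp add: scaleR_conv_of_real)
  have int: "set_integrable lborel {0..2 * pi} (\<lambda>\<theta>. g (cis \<theta>))"
    by (rule borel_integrable_atLeastAtMost') (use cont continuous_on_subset in auto)
  show ?thesis
    unfolding eq set_borel_integral_eq_integral(2)[OF int]
    by (rule integrable_integral set_borel_integral_eq_integral(1) int)+
qed

lemma integral_circle_contour:
  assumes "continuous_on unit_circle g" "((\<lambda>t. g t / t) has_contour_integral I) (circlepath 0 1)"
  shows "(\<integral>t. g t \<partial>circle_lebesgue) = I / (2 * pi * \<i>)"
proof -
  have "((\<lambda>\<theta>. \<i> * g (cis \<theta>)) has_integral I) {0..2 * pi}"
    using assms(2) unfolding circlepath_def has_contour_integral_part_circlepath_iff[OF pi_gt_zero[THEN mult_pos_pos[OF zero_less_numeral]]]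
    by (simp add: field_simps)
  moreover have "((\<lambda>\<theta>. \<i> * g (cis \<theta>)) has_integral (\<i> * (2 * pi * (\<integral>t. g t \<partial>circle_lebesgue)))) {0..2 * pi}"
    by (intro has_integral_mult_right has_integral_circle_lebesgue assms)
  ultimately have "I = \<i> * (2 * pi * (\<integral>t. g t \<partial>circle_lebesgue))"
    by (rule has_integral_unique)
  then show ?thesis by simp
qed

section \<open>The Schwarz and Poisson formulas\<close>

definition poisson_kernel :: "complex \<Rightarrow> complex \<Rightarrow> real" where
  "poisson_kernel z t = Re ((t + z) / (t - z))"

lemma disk_ne_circle: "z \<in> unit_disk \<Longrightarrow> t \<in> unit_circle \<Longrightarrow> t - z \<noteq> 0"
  by auto

lemma continuous_on_schwarz_kernel [continuous_intros]:
  "z \<in> unit_disk \<Longrightarrow> continuous_on unit_circle (\<lambda>t. (t + z) / (t - z))"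
  by (intro continuous_intros ballI disk_ne_circle)

lemma continuous_on_poisson_kernel [continuous_intros]:
  "z \<in> unit_disk \<Longrightarrow> continuous_on unit_circle (\<lambda>t. poisson_kernel z t)"
  unfolding poisson_kernel_def by (intro continuous_intros)

lemma norm_schwarz_kernel_le:
  assumes "z \<in> unit_disk" "t \<in> unit_circle"
  shows "cmod ((t + z) / (t - z)) \<le> 2 / (1 - cmod z)"
proof -
  have "cmod (t + z) \<le> 2" using norm_triangle_ineq[of t z] assms by simp
  moreover have "cmod (t - z) \<ge> 1 - cmod z" using norm_triangle_ineq2[of t z] assms by simp
  ultimately show ?thesis using assms by (simp add: norm_divide frac_le)
qed

lemma poisson_kernel_eq:
  assumes "t \<in> unit_circle"
  shows "poisson_kernel z t = (1 - (cmod z)\<^sup>2) / (cmod (t - z))\<^sup>2"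
proof -
  have t: "(Re t)\<^sup>2 + (Im t)\<^sup>2 = 1"
    using assms by (simp add: cmod_power2[symmetric])
  have "poisson_kernel z t = (Re (t + z) * Re (t - z) + Im (t + z) * Im (t - z)) / (cmod (t - z))\<^sup>2"
    by (simp add: poisson_kernel_def Re_divide' cmod_power2)
  also have "Re (t + z) * Re (t - z) + Im (t + z) * Im (t - z) = 1 - (cmod z)\<^sup>2"
    unfolding cmod_power2 using t by (simp add: power2_eq_square algebra_simps)
  finally show ?thesis .
qed

lemma poisson_kernel_nonneg:
  "z \<in> unit_disk \<Longrightarrow> t \<in> unit_circle \<Longrightarrow> 0 \<le> poisson_kernel z t"
  by (simp add: poisson_kernel_eq abs_square_le_1)

lemma poisson_kernel_le:
  assumes "z \<in> unit_disk" "t \<in> unit_circle"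
  shows "poisson_kernel z t \<le> 2 / (1 - cmod z)"
  using norm_schwarz_kernel_le[OF assms] complex_Re_le_cmod[of "(t + z) / (t - z)"]
  unfolding poisson_kernel_def by linarith

text \<open>
  This symmetry lets a radial dilation pass from one variable of the kernel to the other, and is
  what turns a Poisson integral of a measure into one of a test function.
\<close>
lemma poisson_kernel_swap:
  assumes "s \<in> unit_circle" "t \<in> unit_circle"
  shows "poisson_kernel (of_real r * s) t = poisson_kernel (of_real r * t) s"
proof -
  have "cmod (t - of_real r * s) = cmod (cnj t * (t - of_real r * s))"
    using assms by (simp add: norm_mult)
  also have "cnj t * (t - of_real r * s) = 1 - of_real r * (cnj t * s)"
    using assms by (simp add: algebra_simps complex_norm_square[symmetric] mult.commute[of "cnj t" t])
  also have "cmod \<dots> = cmod (cnj (1 - of_real r * (cnj t * s)))"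
    by (rule complex_mod_cnj[symmetric])
  also have "cnj (1 - of_real r * (cnj t * s)) = cnj s * (s - of_real r * t)"
    using assms by (simp add: algebra_simps complex_norm_square[symmetric] mult.commute[of "cnj s" s])
  also have "cmod \<dots> = cmod (s - of_real r * t)"
    using assms by (simp add: norm_mult)
  finally show ?thesis
    using assms by (simp add: poisson_kernel_eq norm_mult)
qed

lemma (in circle_measure) integrable_schwarz_kernel: 
  "z \<in> unit_disk \<Longrightarrow> integrable M (\<lambda>t. (t + z) / (t - z))"
  by (intro integrable_continuous continuous_intros)

lemma (in circle_measure) Re_schwarz_integral: 
  "z \<in> unit_disk \<Longrightarrow> Re (\<integral>t. (t + z) / (t - z) \<partial>M) = (\<integral>t. poisson_kernel z t \<partial>M)"
  unfolding poisson_kernel_def by (subst integral_Re) (auto intro: integrable_schwarz_kernel)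

lemma cauchy_circle_lebesgue:
  assumes "continuous_on (cball 0 1) G" "G holomorphic_on unit_disk" "w \<in> unit_disk"
  shows "(\<integral>t. t / (t - w) * G t \<partial>circle_lebesgue) = G w"
proof -
  have "((\<lambda>t. G t / (t - w)) has_contour_integral (2 * of_real pi * \<i> * G w)) (circlepath 0 1)"
    using assms by (intro Cauchy_integral_circlepath) auto
  then have "((\<lambda>t. t / (t - w) * G t / t) has_contour_integral (2 * of_real pi * \<i> * G w)) (circlepath 0 1)"
    by (rule has_contour_integral_eq) auto
  then show ?thesis
    using assms disk_ne_circle
    by (subst integral_circle_contour)
       (auto intro!: continuous_intros continuous_on_subset[OF assms(1)])
qed

lemma mean_value_circle_lebesgue:
  assumes "continuous_on (cball 0 1) G" "G holomorphic_on unit_disk"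
  shows "(\<integral>t. G t \<partial>circle_lebesgue) = G 0"
proof -
  have "(\<integral>t. G t \<partial>circle_lebesgue) = (\<integral>t. t / (t - 0) * G t \<partial>circle_lebesgue)"
    by (intro Bochner_Integration.integral_cong) (auto simp: m.space_M)
  then show ?thesis using cauchy_circle_lebesgue[OF assms, of 0] by simp
qed

text \<open>
  The kernel is twice the Cauchy kernel minus one, which reproduces \<open>2 G w - G 0\<close> from \<open>G\<close>.
  Against \<open>cnj G\<close> it only sees the value at the origin: on the circle \<open>cnj t = 1 / t\<close>, so the
  conjugate of the kernel extends to a holomorphic function of \<open>t\<close> on the disk.
\<close>
lemma schwarz_formula:
  assumes cont: "continuous_on (cball 0 1) G" and hol: "G holomorphic_on unit_disk" and w: "w \<in> unit_disk"
  shows "(\<integral>t. (t + w) / (t - w) * of_real (Re (G t)) \<partial>circle_lebesgue) = G w - \<i> * of_real (Im (G 0))"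
proof -
  have contT: "continuous_on unit_circle G" by (rule continuous_on_subset[OF cont]) auto
  have int: "integrable circle_lebesgue (\<lambda>t. t / (t - w) * G t)" "integrable circle_lebesgue G"
    using disk_ne_circle[OF w] by (auto intro!: m.integrable_continuous continuous_intros contT)
  have "(\<integral>t. (t + w) / (t - w) * G t \<partial>circle_lebesgue)
      = (\<integral>t. 2 * (t / (t - w) * G t) - G t \<partial>circle_lebesgue)"
  proof (intro Bochner_Integration.integral_cong refl)
    fix t assume "t \<in> space circle_lebesgue"
    then have "t - w \<noteq> 0" using disk_ne_circle[OF w] by (simp add: m.space_M)
    then show "(t + w) / (t - w) * G t = 2 * (t / (t - w) * G t) - G t"
      by (simp add: field_simps)
  qed
  also have "\<dots> = 2 * G w - G 0"
    using int
    by (subst Bochner_Integration.integral_diff)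
       (simp_all add: cauchy_circle_lebesgue[OF cont hol w] mean_value_circle_lebesgue[OF cont hol]
             del: times_divide_eq_left)
  finally have 1: "(\<integral>t. (t + w) / (t - w) * G t \<partial>circle_lebesgue) = 2 * G w - G 0" .
  \<comment> \<open>The holomorphic extension of the conjugate kernel, times \<open>G\<close>.\<close>
  define K where "K = (\<lambda>t. (1 + cnj w * t) / (1 - cnj w * t) * G t)"
  have nz: "1 - cnj w * t \<noteq> 0" if "t \<in> cball 0 1" for t
  proof
    assume "1 - cnj w * t = 0"
    then have "cmod (cnj w * t) = 1" by (metis eq_iff_diff_eq_0 norm_one)
    moreover have "cmod (cnj w * t) \<le> cmod w * 1"
      unfolding norm_mult complex_mod_cnj using that by (intro mult_left_mono) auto
    ultimately show False using w by simp
  qed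
  have K: "(\<integral>t. K t \<partial>circle_lebesgue) = G 0"
    by (subst mean_value_circle_lebesgue)
       (use nz in \<open>auto simp: K_def intro!: continuous_intros holomorphic_intros cont hol\<close>)
  have "(\<integral>t. (t + w) / (t - w) * cnj (G t) \<partial>circle_lebesgue) = (\<integral>t. cnj (K t) \<partial>circle_lebesgue)"
  proof (intro Bochner_Integration.integral_cong refl)
    fix t assume "t \<in> space circle_lebesgue"
    then have t: "t * cnj t = 1" "t - w \<noteq> 0" "1 - w * cnj t \<noteq> 0" 
      using disk_ne_circle[OF w, of t] nz[of t]
      by (auto simp: m.space_M complex_norm_square[symmetric]) (metis complex_cnj_cnj complex_cnj_mult complex_cnj_one)
    have "(t + w) * (1 - w * cnj t) = (1 + w * cnj t) * (t - w)"
      using t(1) by (simp add: algebra_simps)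
    then show "(t + w) / (t - w) * cnj (G t) = cnj (K t)"
      using t by (simp add: K_def frac_eq_eq)
  qed
  also have "\<dots> = cnj (G 0)" by (simp add: K)
  finally have 2: "(\<integral>t. (t + w) / (t - w) * cnj (G t) \<partial>circle_lebesgue) = cnj (G 0)" .
  have "(\<integral>t. (t + w) / (t - w) * of_real (Re (G t)) \<partial>circle_lebesgue)
     = (\<integral>t. ((t + w) / (t - w) * G t + (t + w) / (t - w) * cnj (G t)) / 2 \<partial>circle_lebesgue)"
  proof (intro Bochner_Integration.integral_cong refl)
    fix t
    have "of_real (Re (G t)) = (G t + cnj (G t)) / 2" by (simp add: complex_add_cnj)
    then show "(t + w) / (t - w) * of_real (Re (G t))
        = ((t + w) / (t - w) * G t + (t + w) / (t - w) * cnj (G t)) / 2"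
      by (simp only: distrib_left times_divide_eq_right)
  qed
  also have "\<dots> = (2 * G w - G 0 + cnj (G 0)) / 2"
    unfolding 1[symmetric] 2[symmetric] integral_divide_zero
    by (subst Bochner_Integration.integral_add)
       (use w in \<open>auto intro!: m.integrable_continuous continuous_intros contT\<close>)
  also have "\<dots> = G w - \<i> * of_real (Im (G 0))"
    by (simp add: complex_eq_iff)
  finally show ?thesis .
qed

lemma schwarz_integral_lebesgue: "w \<in> unit_disk \<Longrightarrow> (\<integral>t. (t + w) / (t - w) \<partial>circle_lebesgue) = 1"
  using schwarz_formula[of "\<lambda>_. 1" w] by simp

lemma poisson_integral_lebesgue: "w \<in> unit_disk \<Longrightarrow> (\<integral>t. poisson_kernel w t \<partial>circle_lebesgue) = 1"
  by (simp add: m.Re_schwarz_integral[symmetric] schwarz_integral_lebesgue)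

text \<open>
  Poisson extensions of continuous functions attain their boundary values, uniformly: near \<open>s\<close> the
  function is almost constant, and far from \<open>s\<close> the kernel is small because its numerator
  \<open>1 - \<bar>w\<bar>\<^sup>2\<close> tends to zero.
\<close>
lemma poisson_integral_boundary:
  fixes g :: "complex \<Rightarrow> real"
  assumes g: "continuous_on unit_circle g" and "e > 0"
  obtains d where "d > 0"
    "\<And>s w. s \<in> unit_circle \<Longrightarrow> w \<in> unit_disk \<Longrightarrow> cmod (s - w) < d \<Longrightarrow>
       \<bar>(\<integral>t. poisson_kernel w t * g t \<partial>circle_lebesgue) - g s\<bar> < e"
proof -
  obtain B where B: "\<And>t. t \<in> unit_circle \<Longrightarrow> \<bar>g t\<bar> \<le> B" "B > 0"
    using compact_imp_bounded[OF compact_continuous_image[OF g compact_sphere]]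
    unfolding bounded_pos real_norm_def by blast
  have "uniformly_continuous_on unit_circle g"
    by (rule compact_uniformly_continuous[OF g compact_sphere])
  from uniformly_continuous_onE[OF this half_gt_zero[OF \<open>e > 0\<close>]]
  obtain \<eta> where \<eta>: "\<eta> > 0"
    "\<And>s t. s \<in> unit_circle \<Longrightarrow> t \<in> unit_circle \<Longrightarrow> dist t s < \<eta> \<Longrightarrow> dist (g t) (g s) < e / 2"
    by metis
  \<comment> \<open>With this \<open>d\<close> the far part contributes at most \<open>e / 4\<close>: there the numerator of the kernel is at
    most \<open>2 d\<close>, the denominator at least \<open>(\<eta> / 2)\<^sup>2\<close>, and \<open>g\<close> varies by at most \<open>2 B\<close>.\<close>
  define d where "d = min (\<eta> / 2) (e * \<eta>\<^sup>2 / (64 * B))"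
  have d: "d > 0" "d \<le> \<eta> / 2" "16 * B * d / \<eta>\<^sup>2 \<le> e / 4"
    using \<eta>(1) B(2) \<open>e > 0\<close> by (auto simp: d_def min_def field_simps)
  show thesis
  proof (rule that[OF d(1)])
    fix s w assume s: "s \<in> unit_circle" and w: "w \<in> unit_disk" and sw: "cmod (s - w) < d"
    let ?P = "poisson_kernel w"
    have bound: "\<bar>?P t * (g t - g s)\<bar> \<le> ?P t * (e / 2) + 16 * B * d / \<eta>\<^sup>2" if t: "t \<in> unit_circle" for t
    proof (cases "dist t s < \<eta>")
      case True
      then have "\<bar>g t - g s\<bar> \<le> e / 2" using \<eta>(2)[OF s t] by (simp add: dist_real_def)
      then have "\<bar>?P t * (g t - g s)\<bar> \<le> ?P t * (e / 2)"
        unfolding abs_mult using poisson_kernel_nonneg[OF w t]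
        by (simp only: abs_of_nonneg mult_left_mono)
      moreover have "0 \<le> 16 * B * d / \<eta>\<^sup>2" using B d by simp
      ultimately show ?thesis by linarith
    next
      case False
      have "cmod (t - s) \<le> cmod (t - w) + cmod (s - w)"
        by (metis norm_triangle_sub norm_minus_commute add.commute dist_norm dist_triangle2)
      then have far: "cmod (t - w) \<ge> \<eta> / 2" using False sw d by (simp add: dist_norm)
      have "1 - cmod w \<le> cmod (s - w)" using norm_triangle_ineq2[of s w] s by simp
      then have "1 - (cmod w)\<^sup>2 \<le> 2 * d"
        using sw w mult_mono[of "1 - cmod w" d "1 + cmod w" 2] d
        by (simp add: power2_eq_square algebra_simps)
      then have "?P t \<le> 2 * d / (\<eta> / 2)\<^sup>2"
        unfolding poisson_kernel_eq[OF t] using far \<eta> d w by (intro frac_le power_mono) auto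
      moreover have "\<bar>g t - g s\<bar> \<le> 2 * B" using B(1)[OF s] B(1)[OF t] by linarith
      ultimately have "\<bar>?P t * (g t - g s)\<bar> \<le> 2 * d / (\<eta> / 2)\<^sup>2 * (2 * B)"
        unfolding abs_mult using poisson_kernel_nonneg[OF w t] d by (intro mult_mono) auto
      also have "\<dots> = 16 * B * d / \<eta>\<^sup>2" by (simp add: power2_eq_square)
      finally show ?thesis using mult_nonneg_nonneg[OF poisson_kernel_nonneg[OF w t], of "e / 2"] \<open>e > 0\<close>
        by linarith
    qed
    have "(\<integral>t. ?P t * g t \<partial>circle_lebesgue) - g s
        = (\<integral>t. ?P t * g t - ?P t * g s \<partial>circle_lebesgue)"
      by (subst Bochner_Integration.integral_diff)
         (auto intro!: m.integrable_continuous continuous_intros g w simp: poisson_integral_lebesgue[OF w])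
    also have "\<dots> = (\<integral>t. ?P t * (g t - g s) \<partial>circle_lebesgue)"
      by (simp add: algebra_simps)
    also have "\<bar>\<dots>\<bar> \<le> (\<integral>t. \<bar>?P t * (g t - g s)\<bar> \<partial>circle_lebesgue)"
      by (rule integral_abs_bound)
    also have "\<dots> \<le> (\<integral>t. ?P t * (e / 2) + 16 * B * d / \<eta>\<^sup>2 \<partial>circle_lebesgue)"
      by (intro integral_mono m.integrable_continuous continuous_intros g w)
         (use bound in \<open>simp add: m.space_M\<close>)
    also have "\<dots> = e / 2 + 16 * B * d / \<eta>\<^sup>2"
      by (subst Bochner_Integration.integral_add)
         (auto intro!: m.integrable_continuous continuous_intros g w simp: poisson_integral_lebesgue[OF w] m.prob_space)
    also have "\<dots> < e" using d \<open>e > 0\<close> by simp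
    finally show "\<bar>(\<integral>t. ?P t * g t \<partial>circle_lebesgue) - g s\<bar> < e" .
  qed
qed

lemma abs_poisson_integral_le:
  fixes g :: "complex \<Rightarrow> real"
  assumes g: "continuous_on unit_circle g" and B: "\<And>t. t \<in> unit_circle \<Longrightarrow> \<bar>g t\<bar> \<le> B" and w: "w \<in> unit_disk"
  shows "\<bar>\<integral>t. poisson_kernel w t * g t \<partial>circle_lebesgue\<bar> \<le> B"
proof -
  have "\<bar>\<integral>t. poisson_kernel w t * g t \<partial>circle_lebesgue\<bar> \<le> (\<integral>t. \<bar>poisson_kernel w t * g t\<bar> \<partial>circle_lebesgue)"
    by (rule integral_abs_bound)
  also have "\<dots> \<le> (\<integral>t. poisson_kernel w t * B \<partial>circle_lebesgue)"
    by (intro integral_mono m.integrable_continuous continuous_intros g w)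
       (use B poisson_kernel_nonneg[OF w] in \<open>simp add: m.space_M abs_mult mult_left_mono\<close>)
  also have "\<dots> = B" using poisson_integral_lebesgue[OF w] by simp
  finally show ?thesis .
qed

lemma integrable_schwarz_density:
  fixes u :: "complex \<Rightarrow> real"
  assumes u: "integrable circle_lebesgue u" and z: "z \<in> unit_disk"
  shows "integrable circle_lebesgue (\<lambda>t. (t + z) / (t - z) * of_real (u t))"
proof (rule Bochner_Integration.integrable_bound)
  show "integrable circle_lebesgue (\<lambda>t. 2 / (1 - cmod z) * u t)" using u by simp
  have "(\<lambda>t. complex_of_real (u t)) \<in> borel_measurable circle_lebesgue" using u by simp
  then show "(\<lambda>t. (t + z) / (t - z) * of_real (u t)) \<in> borel_measurable circle_lebesgue"
    by (rule borel_measurable_times[OF m.borel_measurable_continuous[OF continuous_on_schwarz_kernel[OF z]]])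
  show "AE t in circle_lebesgue. norm ((t + z) / (t - z) * of_real (u t)) \<le> norm (2 / (1 - cmod z) * u t)"
  proof (rule AE_I2)
    fix t assume "t \<in> space circle_lebesgue"
    then have "norm ((t + z) / (t - z)) * \<bar>u t\<bar> \<le> 2 / (1 - cmod z) * \<bar>u t\<bar>"
      by (intro mult_right_mono norm_schwarz_kernel_le z) (auto simp: m.space_M)
    moreover have "norm (2 / (1 - cmod z) * u t) = 2 / (1 - cmod z) * \<bar>u t\<bar>"
      using z by (simp add: abs_mult)
    ultimately show "norm ((t + z) / (t - z) * of_real (u t)) \<le> norm (2 / (1 - cmod z) * u t)"
      by (simp only: norm_mult norm_of_real)
  qed
qed

lemma
  fixes u :: "complex \<Rightarrow> real"
  assumes u: "integrable circle_lebesgue u" and z: "z \<in> unit_disk"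
  shows integrable_poisson_density: "integrable circle_lebesgue (\<lambda>t. poisson_kernel z t * u t)"
    and Re_schwarz_density: "Re (\<integral>t. (t + z) / (t - z) * of_real (u t) \<partial>circle_lebesgue)
      = (\<integral>t. poisson_kernel z t * u t \<partial>circle_lebesgue)"
proof -
  have eq: "poisson_kernel z t * u t = Re ((t + z) / (t - z) * of_real (u t))" for t
    by (simp only: poisson_kernel_def times_complex.sel Re_complex_of_real Im_complex_of_real)
  show "integrable circle_lebesgue (\<lambda>t. poisson_kernel z t * u t)"
    unfolding eq by (intro integrable_Re integrable_schwarz_density u z)
  show "Re (\<integral>t. (t + z) / (t - z) * of_real (u t) \<partial>circle_lebesgue)
      = (\<integral>t. poisson_kernel z t * u t \<partial>circle_lebesgue)"
    unfolding eq by (rule integral_Re[OF integrable_schwarz_density[OF u z], symmetric])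
qed

text \<open>
  Expanding the kernel in a geometric series and integrating termwise gives a power series in \<open>z\<close>.
\<close>
lemma (in circle_measure) holomorphic_schwarz_integral:
  "(\<lambda>z. \<integral>t. (t + z) / (t - z) \<partial>M) holomorphic_on unit_disk"
proof -
  have cauchy: "(\<lambda>z. \<integral>t. t / (t - z) \<partial>M) holomorphic_on ball 0 1"
  proof (rule power_series_holomorphic)
    fix z :: complex assume z: "z \<in> ball 0 1"
    have int: "integrable M (\<lambda>t. (z / t) ^ n)" for n
      by (intro integrable_continuous continuous_intros) auto
    have norm: "norm ((z / t) ^ n) = cmod z ^ n" if "t \<in> space M" for t n
      using that by (simp add: space_M norm_power norm_divide)
    have geo: "(\<Sum>n. (z / t) ^ n) = t / (t - z)" if "t \<in> space M" for t
    proof -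
      have t: "cmod t = 1" using that by (simp add: space_M)
      then have "cmod (z / t) < 1" using z by (simp add: norm_divide)
      then have "(\<Sum>n. (z / t) ^ n) = 1 / (1 - z / t)" by (rule suminf_geometric)
      also have "1 - z / t = (t - z) / t" using t by (auto simp: diff_divide_distrib)
      finally show ?thesis by simp
    qed
    have "(\<lambda>n. \<integral>t. (z / t) ^ n \<partial>M) sums (\<integral>t. (\<Sum>n. (z / t) ^ n) \<partial>M)"
    proof (rule sums_integral[OF int])
      show "AE t in M. summable (\<lambda>n. norm ((z / t) ^ n))"
        using z by (intro AE_I2) (simp add: norm)
      have "summable (\<lambda>n. cmod z ^ n * measure M (space M))"
        using z by (intro summable_mult2 summable_geometric) simp
      also have "(\<lambda>n. cmod z ^ n * measure M (space M)) = (\<lambda>n. \<integral>t. norm ((z / t) ^ n) \<partial>M)"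
        using norm by (simp cong: Bochner_Integration.integral_cong add: mult.commute)
      finally show "summable (\<lambda>n. \<integral>t. norm ((z / t) ^ n) \<partial>M)" .
    qed
    also have "(\<lambda>n. \<integral>t. (z / t) ^ n \<partial>M) = (\<lambda>n. (\<integral>t. 1 / t ^ n \<partial>M) * (z - 0) ^ n)"
    proof
      fix n
      have "(\<integral>t. (z / t) ^ n \<partial>M) = (\<integral>t. 1 / t ^ n * z ^ n \<partial>M)"
        by (simp add: power_divide)
      also have "\<dots> = (\<integral>t. 1 / t ^ n \<partial>M) * (z - 0) ^ n"
        by (subst integral_mult_left_zero) simp
      finally show "(\<integral>t. (z / t) ^ n \<partial>M) = (\<integral>t. 1 / t ^ n \<partial>M) * (z - 0) ^ n" .
    qed
    also have "(\<integral>t. (\<Sum>n. (z / t) ^ n) \<partial>M) = (\<integral>t. t / (t - z) \<partial>M)"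
      using geo by (intro Bochner_Integration.integral_cong) auto
    finally show "(\<lambda>n. (\<integral>t. 1 / t ^ n \<partial>M) * (z - 0) ^ n) sums (\<integral>t. t / (t - z) \<partial>M)" .
  qed
  have "(\<lambda>z. 2 * (\<integral>t. t / (t - z) \<partial>M) - of_real (measure M (space M))) holomorphic_on unit_disk"
    by (intro holomorphic_intros cauchy)
  then show ?thesis
  proof (rule holomorphic_transform)
    fix z assume z: "z \<in> unit_disk"
    have int: "integrable M (\<lambda>t. t / (t - z))"
      using disk_ne_circle[OF z] by (intro integrable_continuous continuous_intros) auto
    have "(\<integral>t. (t + z) / (t - z) \<partial>M) = (\<integral>t. 2 * (t / (t - z)) - 1 \<partial>M)"
    proof (intro Bochner_Integration.integral_cong refl)
      fix t assume "t \<in> space M"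
      then have "t - z \<noteq> 0" using disk_ne_circle[OF z] by (simp add: space_M)
      then show "(t + z) / (t - z) = 2 * (t / (t - z)) - 1" by (simp add: field_simps)
    qed
    also have "\<dots> = 2 * (\<integral>t. t / (t - z) \<partial>M) - of_real (measure M (space M))"
      using int by (subst Bochner_Integration.integral_diff) (simp_all add: scaleR_conv_of_real del: times_divide_eq_right)
    finally show "2 * (\<integral>t. t / (t - z) \<partial>M) - of_real (measure M (space M)) = (\<integral>t. (t + z) / (t - z) \<partial>M)" by simp
  qed
qed

section \<open>Comparing measures through their Poisson integrals\<close>

text \<open>
  A measure \<open>M\<close> and a density \<open>u\<close> over it are carried along together, so that the next lemmas
  apply with \<open>u = 1\<close> to a measure, and with \<open>M\<close> Lebesgue measure to a signed density.
\<close>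
lemma (in circle_measure) integrable_poisson_pairing:
  fixes g u :: "complex \<Rightarrow> real"
  assumes g: "continuous_on unit_circle g" and u: "integrable M u" and r: "0 \<le> r" "r < 1"
  shows "integrable (M \<Otimes>\<^sub>M circle_lebesgue) (\<lambda>(t, s). g s * (poisson_kernel (of_real r * s) t * u t))"
proof -
  interpret pair_sigma_finite M circle_lebesgue ..
  have [measurable]: "(\<lambda>x. x) \<in> borel_measurable M" "(\<lambda>x. x) \<in> borel_measurable circle_lebesgue"
    "g \<in> borel_measurable circle_lebesgue" "u \<in> borel_measurable M"
    using u by (auto intro!: borel_measurable_continuous m.borel_measurable_continuous g continuous_intros)
  have [measurable]: "(\<lambda>x. fst x) \<in> borel_measurable (M \<Otimes>\<^sub>M circle_lebesgue)"
    "(\<lambda>x. snd x) \<in> borel_measurable (M \<Otimes>\<^sub>M circle_lebesgue)"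
    using measurable_compose[OF measurable_fst \<open>(\<lambda>x. x) \<in> borel_measurable M\<close>]
      measurable_compose[OF measurable_snd \<open>(\<lambda>x. x) \<in> borel_measurable circle_lebesgue\<close>] by auto
  obtain B where B: "\<And>t. t \<in> unit_circle \<Longrightarrow> \<bar>g t\<bar> \<le> B" "B > 0"
    using compact_imp_bounded[OF compact_continuous_image[OF g compact_sphere]]
    unfolding bounded_pos real_norm_def by blast
  have int: "integrable (M \<Otimes>\<^sub>M circle_lebesgue) (\<lambda>(t, s). u t)"
    by (rule Fubini_integrable) (use u in \<open>auto simp: m.prob_space\<close>)
  show ?thesis
  proof (rule Bochner_Integration.integrable_bound)
    show "integrable (M \<Otimes>\<^sub>M circle_lebesgue) (\<lambda>x. (B * (2 / (1 - r))) * (case x of (t, s) \<Rightarrow> u t))"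
      by (intro integrable_mult_right int)
    show "(\<lambda>(t, s). g s * (poisson_kernel (of_real r * s) t * u t)) \<in> borel_measurable (M \<Otimes>\<^sub>M circle_lebesgue)"
      unfolding poisson_kernel_def case_prod_beta by measurable
    show "AE x in M \<Otimes>\<^sub>M circle_lebesgue.
       norm (case x of (t, s) \<Rightarrow> g s * (poisson_kernel (of_real r * s) t * u t))
        \<le> norm (B * (2 / (1 - r)) * (case x of (t, s) \<Rightarrow> u t))"
    proof (rule AE_I2, safe)
      fix t s assume "(t, s) \<in> space (M \<Otimes>\<^sub>M circle_lebesgue)"
      then have ts: "t \<in> unit_circle" "s \<in> unit_circle" "of_real r * s \<in> unit_disk"
        using r by (auto simp: space_pair_measure space_M m.space_M norm_mult)
      have P: "0 \<le> poisson_kernel (of_real r * s) t" "poisson_kernel (of_real r * s) t \<le> 2 / (1 - r)"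
        using poisson_kernel_nonneg[OF ts(3,1)] poisson_kernel_le[OF ts(3,1)] ts r by (auto simp: norm_mult)
      have "\<bar>g s\<bar> * poisson_kernel (of_real r * s) t * \<bar>u t\<bar> \<le> B * (2 / (1 - r)) * \<bar>u t\<bar>"
        using B(1)[OF ts(2)] P B(2) by (intro mult_right_mono mult_mono) auto
      then show "norm (g s * (poisson_kernel (of_real r * s) t * u t)) \<le> norm (B * (2 / (1 - r)) * u t)"
        using P B(2) r by (simp add: abs_mult mult.assoc)
    qed
  qed
qed

lemma (in circle_measure) poisson_pairing:
  fixes g u :: "complex \<Rightarrow> real"
  assumes g: "continuous_on unit_circle g" and u: "integrable M u" and r: "0 \<le> r" "r < 1"
  shows "integrable circle_lebesgue (\<lambda>s. g s * (\<integral>t. poisson_kernel (of_real r * s) t * u t \<partial>M))" (is ?th1)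
    and "(\<integral>s. g s * (\<integral>t. poisson_kernel (of_real r * s) t * u t \<partial>M) \<partial>circle_lebesgue)
      = (\<integral>t. (\<integral>s. poisson_kernel (of_real r * t) s * g s \<partial>circle_lebesgue) * u t \<partial>M)" (is ?th2)
    and "(\<lambda>t. (\<integral>s. poisson_kernel (of_real r * t) s * g s \<partial>circle_lebesgue) * u t) \<in> borel_measurable M" (is ?th3)
proof -
  interpret pair_sigma_finite M circle_lebesgue ..
  note int = integrable_poisson_pairing[OF assms]
  show ?th1 using integrable_snd[OF int] by simp
  have eq: "(\<integral>s. g s * (poisson_kernel (of_real r * s) t * u t) \<partial>circle_lebesgue)
     = (\<integral>s. poisson_kernel (of_real r * t) s * g s \<partial>circle_lebesgue) * u t" if "t \<in> space M" for t
  proof -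
    have "(\<integral>s. g s * (poisson_kernel (of_real r * s) t * u t) \<partial>circle_lebesgue)
      = (\<integral>s. (poisson_kernel (of_real r * t) s * g s) * u t \<partial>circle_lebesgue)"
      using that by (intro Bochner_Integration.integral_cong)
        (auto simp: space_M m.space_M poisson_kernel_swap[of _ t])
    then show ?thesis by simp
  qed
  have "(\<integral>s. g s * (\<integral>t. poisson_kernel (of_real r * s) t * u t \<partial>M) \<partial>circle_lebesgue)
     = (\<integral>t. (\<integral>s. g s * (poisson_kernel (of_real r * s) t * u t) \<partial>circle_lebesgue) \<partial>M)"
    using Fubini_integral[OF int] by simp
  then show ?th2
    using eq by (simp cong: Bochner_Integration.integral_cong)
  have "(\<lambda>t. \<integral>s. g s * (poisson_kernel (of_real r * s) t * u t) \<partial>circle_lebesgue) \<in> borel_measurable M"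
    using borel_measurable_integrable[OF integrable_fst[OF int]] by simp
  then show ?th3
    using eq by (simp cong: measurable_cong)
qed

text \<open>
  By Fubini and the symmetry of the kernel, pairing the dilated Poisson integral of \<open>u dM\<close> with \<open>g\<close>
  amounts to pairing \<open>u dM\<close> with the dilated Poisson integral of \<open>g\<close>, which converges uniformly
  to \<open>g\<close>.
\<close>
lemma (in circle_measure) poisson_pairing_tendsto:
  fixes g u :: "complex \<Rightarrow> real"
  assumes g: "continuous_on unit_circle g" and u: "integrable M u"
    and r: "\<And>n. 0 \<le> r n" "\<And>n. r n < 1" "r \<longlonglongrightarrow> 1"
  shows "(\<lambda>n. \<integral>s. g s * (\<integral>t. poisson_kernel (of_real (r n) * s) t * u t \<partial>M) \<partial>circle_lebesgue)
    \<longlonglongrightarrow> (\<integral>t. g t * u t \<partial>M)"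
proof -
  obtain B where B: "\<And>t. t \<in> unit_circle \<Longrightarrow> \<bar>g t\<bar> \<le> B" "B > 0"
    using compact_imp_bounded[OF compact_continuous_image[OF g compact_sphere]]
    unfolding bounded_pos real_norm_def by blast
  have disk: "of_real (r n) * t \<in> unit_disk" if "t \<in> unit_circle" for n t
    using that r(1,2)[of n] by (simp add: norm_mult)
  have "(\<lambda>n. \<integral>t. (\<integral>s. poisson_kernel (of_real (r n) * t) s * g s \<partial>circle_lebesgue) * u t \<partial>M)
     \<longlonglongrightarrow> (\<integral>t. g t * u t \<partial>M)"
  proof (rule integral_dominated_convergence)
    show "integrable M (\<lambda>t. B * \<bar>u t\<bar>)" using u by simp
    show "(\<lambda>t. g t * u t) \<in> borel_measurable M"
      using borel_measurable_times[OF borel_measurable_continuous[OF g] borel_measurable_integrable[OF u]] .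
    show "(\<lambda>t. (\<integral>s. poisson_kernel (of_real (r n) * t) s * g s \<partial>circle_lebesgue) * u t) \<in> borel_measurable M" for n
      by (rule poisson_pairing[OF g u r(1,2)])
    show "AE t in M. norm ((\<integral>s. poisson_kernel (of_real (r n) * t) s * g s \<partial>circle_lebesgue) * u t)
        \<le> B * \<bar>u t\<bar>" for n
      using abs_poisson_integral_le[OF g B(1) disk]
      by (intro AE_I2) (auto simp: space_M abs_mult intro!: mult_right_mono)
    show "AE t in M. (\<lambda>n. (\<integral>s. poisson_kernel (of_real (r n) * t) s * g s \<partial>circle_lebesgue) * u t) \<longlonglongrightarrow> g t * u t"
    proof (rule AE_I2)
      fix t assume "t \<in> space M"
      then have t: "t \<in> unit_circle" by (simp add: space_M)
      have "(\<lambda>n. \<integral>s. poisson_kernel (of_real (r n) * t) s * g s \<partial>circle_lebesgue) \<longlonglongrightarrow> g t"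
      proof (rule tendstoI)
        fix e :: real assume "e > 0"
        from poisson_integral_boundary[OF g this] obtain d where d: "d > 0"
          "\<And>s w. s \<in> unit_circle \<Longrightarrow> w \<in> unit_disk \<Longrightarrow> cmod (s - w) < d \<Longrightarrow>
             \<bar>(\<integral>t. poisson_kernel w t * g t \<partial>circle_lebesgue) - g s\<bar> < e" by metis
        have "eventually (\<lambda>n. dist (r n) 1 < d) sequentially"
          using r(3) d(1) by (rule tendstoD)
        then show "eventually (\<lambda>n. dist (\<integral>s. poisson_kernel (of_real (r n) * t) s * g s \<partial>circle_lebesgue) (g t) < e) sequentially"
        proof eventually_elim
          case (elim n)
          have "cmod (t - of_real (r n) * t) = cmod (of_real (1 - r n) * t)" by (simp add: algebra_simps)
          also have "\<dots> < d" using elim t r(2)[of n] by (simp add: norm_mult dist_real_def del: of_real_diff)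
          finally show ?case unfolding dist_real_def by (rule d(2)[OF t disk[OF t]])
        qed
      qed
      then show "(\<lambda>n. (\<integral>s. poisson_kernel (of_real (r n) * t) s * g s \<partial>circle_lebesgue) * u t) \<longlonglongrightarrow> g t * u t"
        by (intro tendsto_intros)
    qed
  qed
  then show ?thesis using poisson_pairing(2)[OF g u r(1,2)] by simp
qed

lemma (in circle_measure) tendsto_integral_indicator:
  fixes u :: "complex \<Rightarrow> real"
  assumes u: "integrable M u" and K: "closed K" "K \<subseteq> unit_circle" "K \<noteq> {}"
  shows "(\<lambda>k. \<integral>t. max 0 (1 - real k * infdist t K) * u t \<partial>M) \<longlonglongrightarrow> (\<integral>t. indicator K t * u t \<partial>M)"
proof (rule integral_dominated_convergence)
  show "integrable M (\<lambda>t. \<bar>u t\<bar>)" using u by simp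
  have [measurable]: "u \<in> borel_measurable M" "K \<in> sets M"
    using u K by (auto intro!: borel_set_M)
  show "(\<lambda>t. indicator K t * u t) \<in> borel_measurable M" by measurable
  show "(\<lambda>t. max 0 (1 - real k * infdist t K) * u t) \<in> borel_measurable M" for k
    by (intro borel_measurable_times borel_measurable_integrable[OF u] borel_measurable_continuous continuous_intros)
  show "AE t in M. norm (max 0 (1 - real k * infdist t K) * u t) \<le> \<bar>u t\<bar>" for k
    by (intro AE_I2) (auto simp: abs_mult infdist_nonneg intro!: mult_left_le_one_le)
  show "AE t in M. (\<lambda>k. max 0 (1 - real k * infdist t K) * u t) \<longlonglongrightarrow> indicator K t * u t"
  proof (rule AE_I2)
    fix t
    have "(\<lambda>k. max 0 (1 - real k * infdist t K)) \<longlonglongrightarrow> indicator K t"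
    proof (cases "t \<in> K")
      case True then show ?thesis by simp
    next
      case False
      then have pos: "infdist t K > 0"
        using K by (metis in_closed_iff_infdist_zero infdist_nonneg less_eq_real_def)
      obtain k0 where "1 / infdist t K < real k0" using reals_Archimedean2 by blast
      then have "max 0 (1 - real k * infdist t K) = 0" if "k \<ge> k0" for k
      proof -
        have "1 / infdist t K \<le> real k" using \<open>_ < real k0\<close> that by linarith
        then show ?thesis using pos by (simp add: field_simps)
      qed
      then have "eventually (\<lambda>k. max 0 (1 - real k * infdist t K) = 0) sequentially"
        using eventually_sequentially by blast
      then show ?thesis using False by (simp add: tendsto_eventually)
    qed
    then show "(\<lambda>k. max 0 (1 - real k * infdist t K) * u t) \<longlonglongrightarrow> indicator K t * u t"
      by (intro tendsto_intros)
  qed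
qed

text \<open>
  Pair the inequality on the circle of radius \<open>r\<close> with a continuous test function having values in
  \<open>[0, 1]\<close>; the term \<open>w\<close> then contributes at most \<open>C\<close>.  Let \<open>r\<close> tend to 1, and afterwards let the
  test functions decrease to the indicator of \<open>K\<close>.
\<close>
lemma measure_le_of_poisson_integral_le:
  fixes u w :: "complex \<Rightarrow> real"
  assumes "circle_measure \<mu>" "circle_measure \<nu>" and u: "integrable circle_lebesgue u"
    and w: "continuous_on unit_disk w" "\<And>z. z \<in> unit_disk \<Longrightarrow> 0 \<le> w z"
      "\<And>r. 0 < r \<Longrightarrow> r < 1 \<Longrightarrow> (\<integral>t. w (of_real r * t) \<partial>circle_lebesgue) \<le> C"
    and le: "\<And>z. z \<in> unit_disk \<Longrightarrow> (\<integral>t. poisson_kernel z t \<partial>\<mu>)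
      \<le> (\<integral>t. poisson_kernel z t \<partial>\<nu>) + (\<integral>t. poisson_kernel z t * u t \<partial>circle_lebesgue) + w z"
    and K: "compact K" "K \<subseteq> unit_circle"
  shows "measure \<mu> K \<le> measure \<nu> K + (\<integral>t. indicator K t * u t \<partial>circle_lebesgue) + C"
proof (cases "K = {}")
  case True
  have "0 \<le> (\<integral>t. w (of_real (1/2) * t) \<partial>circle_lebesgue)"
    by (intro integral_nonneg_AE AE_I2 w(2)) (simp add: m.space_M norm_mult)
  then show ?thesis using True w(3)[of "1/2"] by simp
next
  case False
  interpret l1: circle_measure \<mu> by fact
  interpret l2: circle_measure \<nu> by fact
  have clK: "closed K" by (rule compact_imp_closed[OF K(1)])
  define r where "r = (\<lambda>n. 1 - 1 / (real n + 2))"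
  have r: "0 \<le> r n" "0 < r n" "r n < 1" for n by (auto simp: r_def field_simps)
  have r1: "r \<longlonglongrightarrow> 1" unfolding r_def by real_asymp
  have disk: "of_real (r n) * t \<in> unit_disk" if "t \<in> unit_circle" for n t
    using that r[of n] by (simp add: norm_mult)
  have cont_w: "continuous_on unit_circle (\<lambda>t. w (of_real (r n) * t))" for n
    by (intro continuous_on_compose2[OF w(1)] continuous_intros) (use disk in auto)
  have step: "(\<integral>t. g t * 1 \<partial>\<mu>) \<le> (\<integral>t. g t * 1 \<partial>\<nu>) + (\<integral>t. g t * u t \<partial>circle_lebesgue) + C"
    if g: "continuous_on unit_circle g" "\<And>t. 0 \<le> g t" "\<And>t. g t \<le> 1" for g
  proof (rule LIMSEQ_le)
    let ?A = "\<lambda>n M u. \<integral>s. g s * (\<integral>t. poisson_kernel (of_real (r n) * s) t * u t \<partial>M) \<partial>circle_lebesgue"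
    show "(\<lambda>n. ?A n \<mu> (\<lambda>_. 1)) \<longlonglongrightarrow> (\<integral>t. g t * 1 \<partial>\<mu>)"
      by (rule l1.poisson_pairing_tendsto[OF g(1) _ r(1,3) r1]) simp
    show "(\<lambda>n. ?A n \<nu> (\<lambda>_. 1) + ?A n circle_lebesgue u + C)
       \<longlonglongrightarrow> (\<integral>t. g t * 1 \<partial>\<nu>) + (\<integral>t. g t * u t \<partial>circle_lebesgue) + C"
      by (intro tendsto_intros l2.poisson_pairing_tendsto[OF g(1) _ r(1,3) r1]
         m.poisson_pairing_tendsto[OF g(1) _ r(1,3) r1] u) simp
    have "?A n \<mu> (\<lambda>_. 1) \<le> ?A n \<nu> (\<lambda>_. 1) + ?A n circle_lebesgue u + C" for n
    proof -
      note int = l1.poisson_pairing(1)[OF g(1) _ r(1,3)[of n], of "\<lambda>_. 1", simplified]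
         l2.poisson_pairing(1)[OF g(1) _ r(1,3)[of n], of "\<lambda>_. 1", simplified]
         m.poisson_pairing(1)[OF g(1) u r(1,3)[of n]]
      have intw: "integrable circle_lebesgue (\<lambda>s. g s * w (of_real (r n) * s))"
        by (intro m.integrable_continuous continuous_intros cont_w g)
      have "?A n \<mu> (\<lambda>_. 1) \<le> (\<integral>s. g s * (\<integral>t. poisson_kernel (of_real (r n) * s) t \<partial>\<nu>)
           + g s * (\<integral>t. poisson_kernel (of_real (r n) * s) t * u t \<partial>circle_lebesgue)
           + g s * w (of_real (r n) * s) \<partial>circle_lebesgue)"
      proof (rule integral_mono)
        fix s assume "s \<in> space circle_lebesgue"
        then have s: "s \<in> unit_circle" by (simp add: m.space_M)
        show "g s * (\<integral>t. poisson_kernel (of_real (r n) * s) t * 1 \<partial>\<mu>) \<le>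
          g s * (\<integral>t. poisson_kernel (of_real (r n) * s) t \<partial>\<nu>)
           + g s * (\<integral>t. poisson_kernel (of_real (r n) * s) t * u t \<partial>circle_lebesgue)
           + g s * w (of_real (r n) * s)"
          using mult_left_mono[OF le[OF disk[OF s]] g(2)] by (simp add: distrib_left)
      qed (use int intw in simp_all)
      also have "\<dots> = ?A n \<nu> (\<lambda>_. 1) + ?A n circle_lebesgue u
          + (\<integral>s. g s * w (of_real (r n) * s) \<partial>circle_lebesgue)"
        using int intw by simp
      also have "(\<integral>s. g s * w (of_real (r n) * s) \<partial>circle_lebesgue) \<le> (\<integral>s. w (of_real (r n) * s) \<partial>circle_lebesgue)"
        using intw m.integrable_continuous[OF cont_w]
      proof (rule integral_mono)
        fix s assume "s \<in> space circle_lebesgue"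
        then have "0 \<le> w (of_real (r n) * s)" by (intro w(2) disk) (simp add: m.space_M)
        then show "g s * w (of_real (r n) * s) \<le> w (of_real (r n) * s)"
          using g by (simp add: mult_left_le_one_le)
      qed
      also have "\<dots> \<le> C" by (rule w(3)[OF r(2,3)])
      finally show ?thesis by simp
    qed
    then show "\<exists>N. \<forall>n\<ge>N. ?A n \<mu> (\<lambda>_. 1) \<le> ?A n \<nu> (\<lambda>_. 1) + ?A n circle_lebesgue u + C" by blast
  qed
  let ?g = "\<lambda>k t. max 0 (1 - real k * infdist t K)"
  have "(\<integral>t. indicator K t * 1 \<partial>\<mu>) \<le> (\<integral>t. indicator K t * 1 \<partial>\<nu>) + (\<integral>t. indicator K t * u t \<partial>circle_lebesgue) + C"
  proof (rule LIMSEQ_le)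
    show "(\<lambda>k. \<integral>t. ?g k t * 1 \<partial>\<mu>) \<longlonglongrightarrow> (\<integral>t. indicator K t * 1 \<partial>\<mu>)"
      by (rule l1.tendsto_integral_indicator[OF _ clK K(2) False]) simp
    show "(\<lambda>k. (\<integral>t. ?g k t * 1 \<partial>\<nu>) + (\<integral>t. ?g k t * u t \<partial>circle_lebesgue) + C)
      \<longlonglongrightarrow> (\<integral>t. indicator K t * 1 \<partial>\<nu>) + (\<integral>t. indicator K t * u t \<partial>circle_lebesgue) + C"
      by (intro tendsto_intros l2.tendsto_integral_indicator[OF _ clK K(2) False]
            m.tendsto_integral_indicator[OF _ clK K(2) False] u) simp
    have "(\<integral>t. ?g k t * 1 \<partial>\<mu>) \<le> (\<integral>t. ?g k t * 1 \<partial>\<nu>) + (\<integral>t. ?g k t * u t \<partial>circle_lebesgue) + C" for k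
      by (rule step) (auto intro!: continuous_intros simp: infdist_nonneg)
    then show "\<exists>N. \<forall>k\<ge>N. (\<integral>t. ?g k t * 1 \<partial>\<mu>)
       \<le> (\<integral>t. ?g k t * 1 \<partial>\<nu>) + (\<integral>t. ?g k t * u t \<partial>circle_lebesgue) + C" by blast
  qed
  moreover have "K \<inter> space \<mu> = K" "K \<inter> space \<nu> = K"
    using K(2) by (auto simp: l1.space_M l2.space_M)
  ultimately show ?thesis by (simp add: Int_commute)
qed

section \<open>Herglotz's theorem and the existence of the singular part\<close>

text \<open>
  Helly's theorem concerns distributions on the real line, so a probability density \<open>k\<close> on the
  circle is unrolled to \<open>[0, 2\<pi>)\<close>.
\<close>
lemma circle_density_real_distribution:
  fixes k :: "complex \<Rightarrow> real"
  assumes k: "continuous_on unit_circle k" "\<And>t. t \<in> unit_circle \<Longrightarrow> 0 \<le> k t"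
    and k1: "(\<integral>t. k t \<partial>circle_lebesgue) = 1"
  defines "N \<equiv> density lborel (\<lambda>\<theta>. ennreal (indicator {0..<2 * pi} \<theta> / (2 * pi) * k (cis \<theta>)))"
  shows "real_distribution N" and "measure N {-1<..2 * pi} = 1"
    and "continuous_on unit_circle f \<Longrightarrow> (\<integral>\<theta>. f (cis \<theta>) \<partial>N) = (\<integral>t. f t * complex_of_real (k t) \<partial>circle_lebesgue)"
proof -
  let ?d = "\<lambda>\<theta>. indicator {0..<2 * pi} \<theta> / (2 * pi) * k (cis \<theta>)"
  have cont: "continuous_on UNIV (\<lambda>\<theta>. k (cis \<theta>))"
    by (intro continuous_on_compose2[OF k(1)]) (auto intro!: continuous_intros)
  have [measurable]: "(\<lambda>\<theta>. k (cis \<theta>)) \<in> borel_measurable borel"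
    by (rule borel_measurable_continuous_onI[OF cont])
  have nn: "0 \<le> ?d \<theta>" for \<theta> using k(2)[of "cis \<theta>"] by simp
  have k_meas: "k \<in> borel_measurable circle_borel"
    using m.borel_measurable_continuous[OF k(1)] by (simp add: m.measurable_M)
  have "integrable circle_lebesgue k" by (rule m.integrable_continuous[OF k(1)])
  then have int: "integrable lborel ?d"
    unfolding circle_lebesgue_eq
    by (subst (asm) integrable_distr_eq, use k_meas in measurable)
       (subst (asm) integrable_density, auto)
  have I1: "(\<integral>\<theta>. ?d \<theta> \<partial>lborel) = 1"
    using integral_circle_lebesgue_density[OF k_meas] k1 by simp
  have em: "emeasure N (space N) = 1"
    unfolding N_def using int I1 nn
    by (simp add: emeasure_density nn_integral_eq_integral)
  then have P: "prob_space N" by (rule prob_spaceI)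
  then interpret N: prob_space N .
  have setsN: "sets N = sets borel" by (simp add: N_def)
  then show "real_distribution N"
    by (intro real_distribution.intro real_distribution_axioms.intro P)
  have "AE \<theta> in N. \<theta> \<in> {-1<..2 * pi}"
    unfolding N_def by (subst AE_density) (auto split: split_indicator intro!: AE_I2)
  then show "measure N {-1<..2 * pi} = 1"
    by (subst N.prob_eq_1) (simp_all add: setsN)
  assume f: "continuous_on unit_circle f"
  have cont_f: "continuous_on UNIV (\<lambda>\<theta>. f (cis \<theta>))"
    by (intro continuous_on_compose2[OF f(1)]) (auto intro!: continuous_intros)
  have [measurable]: "(\<lambda>\<theta>. f (cis \<theta>)) \<in> borel_measurable borel"
    by (rule borel_measurable_continuous_onI[OF cont_f])
  have fk: "(\<lambda>t. f t * complex_of_real (k t)) \<in> borel_measurable circle_borel"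
    using m.borel_measurable_continuous[OF continuous_on_mult[OF f continuous_on_of_real[OF k(1)]]]
    by (simp add: m.measurable_M)
  show "(\<integral>\<theta>. f (cis \<theta>) \<partial>N) = (\<integral>t. f t * complex_of_real (k t) \<partial>circle_lebesgue)"
    unfolding N_def integral_circle_lebesgue_density[OF fk]
    by (subst integral_density, measurable)
       (use nn in \<open>simp_all add: scaleR_conv_of_real mult_ac\<close>)
qed

text \<open>
  The Schwarz formula represents each dilation of \<open>H\<close> by its real part on the circle.  Divided by
  \<open>Re (H 0)\<close>, these densities are probability distributions supported in a fixed interval, so a
  subsequence converges weakly.  The image of its limit under \<open>cis\<close> is a measure on the circle
  even if mass has moved to the endpoint \<open>2\<pi>\<close>.
\<close>
theorem herglotz_representation:
  assumes hol: "H holomorphic_on unit_disk"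
    and nn: "\<And>z. z \<in> unit_disk \<Longrightarrow> 0 \<le> Re (H z)" and pos: "0 < Re (H 0)"
  obtains \<nu> where "circle_measure \<nu>"
    "\<And>z. z \<in> unit_disk \<Longrightarrow> H z = (\<integral>t. (t + z) / (t - z) \<partial>\<nu>) + \<i> * of_real (Im (H 0))"
proof -
  define c where "c = Re (H 0)"
  define r where "r = (\<lambda>n. 1 - 1 / (real n + 2))"
  have r: "0 < r n" "r n < 1" for n by (auto simp: r_def field_simps)
  have r1: "r \<longlonglongrightarrow> 1" unfolding r_def by real_asymp
  define G where "G = (\<lambda>n z. H (of_real (r n) * z))"
  have in_disk: "of_real (r n) * z \<in> unit_disk" if "z \<in> cball 0 1" for n z
  proof -
    have "cmod (of_real (r n) * z) \<le> r n * 1"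
      unfolding norm_mult using r[of n] that by (auto intro!: mult_mono)
    then show ?thesis using r(2)[of n] by simp
  qed
  have contG: "continuous_on (cball 0 1) (G n)" for n
    unfolding G_def
    by (intro continuous_on_compose2[OF holomorphic_on_imp_continuous_on[OF hol]] continuous_intros)
       (use in_disk in auto)
  have holG: "G n holomorphic_on unit_disk" for n
    unfolding G_def
    by (intro holomorphic_on_compose_gen[OF _ hol, unfolded o_def] holomorphic_intros)
       (use in_disk in \<open>auto simp: image_subset_iff\<close>)
  define k where "k = (\<lambda>n t. Re (G n t) / c)"
  have k: "continuous_on unit_circle (k n)" "\<And>t. t \<in> unit_circle \<Longrightarrow> 0 \<le> k n t" for n
  proof -
    show "continuous_on unit_circle (k n)"
      unfolding k_def using pos
      by (intro continuous_intros continuous_on_subset[OF contG]) (auto simp: c_def)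
    show "0 \<le> k n t" if "t \<in> unit_circle" for t
      using nn[OF in_disk[of t n]] that pos by (auto simp: k_def G_def c_def)
  qed
  have schwarz: "(\<integral>t. (t + w) / (t - w) * complex_of_real (k n t) \<partial>circle_lebesgue)
      = (H (of_real (r n) * w) - \<i> * of_real (Im (H 0))) / of_real c" if "w \<in> unit_disk" for n w
  proof -
    have "(\<integral>t. (t + w) / (t - w) * complex_of_real (k n t) \<partial>circle_lebesgue)
       = (\<integral>t. (t + w) / (t - w) * of_real (Re (G n t)) / of_real c \<partial>circle_lebesgue)"
      by (simp add: k_def)
    also have "\<dots> = (\<integral>t. (t + w) / (t - w) * of_real (Re (G n t)) \<partial>circle_lebesgue) / of_real c"
      by (rule integral_divide_zero)
    also have "\<dots> = (G n w - \<i> * of_real (Im (G n 0))) / of_real c"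
      by (subst schwarz_formula[OF contG holG that]) rule
    finally show ?thesis by (simp add: G_def)
  qed
  have k1: "(\<integral>t. k n t \<partial>circle_lebesgue) = 1" for n
  proof -
    have "complex_of_real (\<integral>t. k n t \<partial>circle_lebesgue) = (\<integral>t. complex_of_real (k n t) \<partial>circle_lebesgue)"
      by simp
    also have "\<dots> = (\<integral>t. (t + 0) / (t - 0) * complex_of_real (k n t) \<partial>circle_lebesgue)"
      by (intro Bochner_Integration.integral_cong) (auto simp: m.space_M)
    also have "\<dots> = (H 0 - \<i> * of_real (Im (H 0))) / of_real c"
      by (subst schwarz) simp_all
    also have "H 0 - \<i> * of_real (Im (H 0)) = of_real c" by (simp add: c_def complex_eq_iff)
    also have "of_real c / of_real c = (1::complex)" using pos by (simp add: c_def)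
    finally show ?thesis using of_real_eq_1_iff by blast
  qed
  define N where "N n = density lborel (\<lambda>\<theta>. ennreal (indicator {0..<2 * pi} \<theta> / (2 * pi) * k n (cis \<theta>)))" for n
  note N = circle_density_real_distribution[OF k k1, folded N_def]
  have "tight N"
    unfolding tight_def
  proof (intro conjI allI impI N(1))
    fix e :: real assume "e > 0"
    moreover have "-1 < 2 * pi" using pi_gt_zero by linarith
    ultimately show "\<exists>a b. a < b \<and> (\<forall>n. 1 - e < measure (N n) {a<..b})"
      using N(2) by (intro exI[of _ "-1"] exI[of _ "2 * pi"]) simp
  qed
  from tight_imp_convergent_subsubsequence[OF this strict_mono_id]
  obtain s M where s: "strict_mono s" and M: "real_distribution M" and conv: "weak_conv_m (N \<circ> s) M"
    by (auto simp: o_def id_def)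
  interpret M: real_distribution M by fact
  have cis_M [measurable]: "cis \<in> measurable M circle_borel"
    using measurable_cis by (simp cong: measurable_cong_sets)
  define \<nu> where "\<nu> = density (distr M circle_borel cis) (\<lambda>_. ennreal c)"
  have \<nu>: "circle_measure \<nu>"
  proof (intro circle_measure.intro circle_measure_axioms.intro)
    interpret D: prob_space "distr M circle_borel cis" by (rule M.prob_space_distr[OF cis_M])
    show "finite_measure \<nu>"
      by (rule finite_measureI)
         (simp add: \<nu>_def emeasure_density ennreal_mult_eq_top_iff nn_integral_cmult D.emeasure_space_1)
  qed (simp add: \<nu>_def)
  show thesis
  proof (rule that[OF \<nu>])
    fix z assume z: "z \<in> unit_disk"
    let ?f = "\<lambda>\<theta>. (cis \<theta> + z) / (cis \<theta> - z)"
    interpret \<mu>: real_distribution "(N \<circ> s) n" for n using N(1) by simp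
    have lim: "(\<lambda>n. \<integral>\<theta>. ?f \<theta> \<partial>((N \<circ> s) n)) \<longlonglongrightarrow> (\<integral>\<theta>. ?f \<theta> \<partial>M)"
    proof (rule weak_conv_imp_integral_bdd_continuous_conv[OF _ M conv])
      show "real_distribution ((N \<circ> s) n)" for n using N(1) by simp
      have "continuous_on UNIV ?f"
        by (intro continuous_on_compose2[OF continuous_on_schwarz_kernel[OF z]]) (auto intro!: continuous_intros)
      then show "isCont ?f x" for x by (simp add: continuous_on_eq_continuous_at)
      show "norm (?f x) \<le> 2 / (1 - cmod z)" for x by (rule norm_schwarz_kernel_le[OF z]) simp
    qed
    have "(\<lambda>n. of_real (r (s n)) * z) \<longlonglongrightarrow> of_real 1 * z"
      using LIMSEQ_subseq_LIMSEQ[OF r1 s] by (intro tendsto_intros) (simp add: o_def)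
    moreover have "isCont H z"
      using holomorphic_on_imp_continuous_on[OF hol] z continuous_on_eq_continuous_at[OF open_ball] by blast
    ultimately have "(\<lambda>n. H (of_real (r (s n)) * z)) \<longlonglongrightarrow> H z"
      using isCont_tendsto_compose[of z H] by simp
    then have "(\<lambda>n. (H (of_real (r (s n)) * z) - \<i> * of_real (Im (H 0))) / of_real c)
       \<longlonglongrightarrow> (H z - \<i> * of_real (Im (H 0))) / of_real c"
      using pos by (intro tendsto_intros) (auto simp: c_def)
    also have "(\<lambda>n. (H (of_real (r (s n)) * z) - \<i> * of_real (Im (H 0))) / of_real c)
       = (\<lambda>n. \<integral>\<theta>. ?f \<theta> \<partial>((N \<circ> s) n))"
    proof
      fix n
      have "(\<integral>\<theta>. ?f \<theta> \<partial>N (s n)) = (\<integral>t. (t + z) / (t - z) * complex_of_real (k (s n) t) \<partial>circle_lebesgue)"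
        by (rule N(3)[where f = "\<lambda>t. (t + z) / (t - z)"]) (use continuous_on_schwarz_kernel[OF z] in auto)
      then show "(H (of_real (r (s n)) * z) - \<i> * of_real (Im (H 0))) / of_real c = (\<integral>\<theta>. ?f \<theta> \<partial>((N \<circ> s) n))"
        unfolding schwarz[OF z] o_def by (rule sym)
    qed
    finally have "(\<integral>\<theta>. ?f \<theta> \<partial>M) = (H z - \<i> * of_real (Im (H 0))) / of_real c"
      using LIMSEQ_unique[OF lim] by simp
    moreover have "(\<integral>t. (t + z) / (t - z) \<partial>\<nu>) = of_real c * (\<integral>\<theta>. ?f \<theta> \<partial>M)"
    proof -
      have f: "(\<lambda>t. (t + z) / (t - z)) \<in> borel_measurable circle_borel"
        using m.borel_measurable_continuous[OF continuous_on_schwarz_kernel[OF z]] by (simp add: m.measurable_M)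
      have "(\<integral>t. (t + z) / (t - z) \<partial>\<nu>) = (\<integral>t. c *\<^sub>R ((t + z) / (t - z)) \<partial>distr M circle_borel cis)"
        unfolding \<nu>_def using pos f by (intro integral_density) (auto simp: c_def)
      also have "\<dots> = c *\<^sub>R (\<integral>t. (t + z) / (t - z) \<partial>distr M circle_borel cis)"
        by (rule integral_scaleR_right)
      also have "(\<integral>t. (t + z) / (t - z) \<partial>distr M circle_borel cis) = (\<integral>\<theta>. ?f \<theta> \<partial>M)"
        by (rule integral_distr[OF cis_M f])
      finally show ?thesis by (simp add: scaleR_conv_of_real)
    qed
    ultimately show "H z = (\<integral>t. (t + z) / (t - z) \<partial>\<nu>) + \<i> * of_real (Im (H 0))"
      using pos by (simp add: c_def)
  qed
qed

text \<open>
  A null set that takes as much of \<open>M\<close> as possible carries its singular part: the rest of \<open>M\<close>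
  vanishes on every null set, as otherwise the maximal set could be enlarged.
\<close>
lemma (in circle_measure) maximal_null_set:
  obtains N where "N \<in> null_sets circle_lebesgue"
    "\<And>A. A \<in> null_sets circle_lebesgue \<Longrightarrow> measure M A \<le> measure M N"
proof -
  let ?V = "measure M ` null_sets circle_lebesgue"
  have bdd: "bdd_above ?V" by (intro bdd_aboveI[of _ "measure M (space M)"]) (auto simp: bounded_measure)
  have ne: "?V \<noteq> {}" using null_sets.empty_sets[of circle_lebesgue] by blast
  have "\<exists>A\<in>null_sets circle_lebesgue. Sup ?V - 1 / real (Suc n) < measure M A" for n
    using less_cSup_iff[OF ne bdd, of "Sup ?V - 1 / real (Suc n)"] by auto
  then obtain A where A: "\<And>n. A n \<in> null_sets circle_lebesgue"
    "\<And>n. Sup ?V - 1 / real (Suc n) < measure M (A n)" by metis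
  define N where "N = (\<Union>n. A n)"
  have N: "N \<in> null_sets circle_lebesgue" unfolding N_def using A(1) by (rule null_sets_UN)
  have sets: "B \<in> null_sets circle_lebesgue \<Longrightarrow> B \<in> sets M" for B
    by (simp add: null_sets_def sets_M m.sets_M)
  have approx: "Sup ?V \<le> measure M N + 1 / real (Suc n)" for n
  proof -
    have "measure M (A n) \<le> measure M N"
      by (intro finite_measure_mono sets N) (auto simp: N_def)
    with A(2)[of n] show ?thesis by linarith
  qed
  have "Sup ?V \<le> measure M N"
  proof (rule field_le_epsilon)
    fix e :: real assume "0 < e"
    then obtain n where "1 / real (Suc n) < e" by (rule nat_approx_posE)
    then show "Sup ?V \<le> measure M N + e" using approx[of n] by linarith
  qed
  then show thesis
    using that[OF N] cSup_upper[OF imageI bdd] by (meson order_trans)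
qed

text \<open>
  The decomposition is stated through integrals of continuous functions, which is how it acts on
  Schwarz integrals.
\<close>
lemma (in circle_measure) lebesgue_decomposition:
  obtains \<sigma> D where "singular_circle_measure \<sigma>" "integrable circle_lebesgue (D :: complex \<Rightarrow> real)"
    "\<And>f :: complex \<Rightarrow> complex. continuous_on unit_circle f \<Longrightarrow>
       (\<integral>t. f t \<partial>M) = (\<integral>t. f t \<partial>\<sigma>) + (\<integral>t. f t * of_real (D t) \<partial>circle_lebesgue)"
proof -
  obtain N where N: "N \<in> null_sets circle_lebesgue"
    and max: "\<And>A. A \<in> null_sets circle_lebesgue \<Longrightarrow> measure M A \<le> measure M N"
    using maximal_null_set by blast
  have sets: "B \<in> null_sets circle_lebesgue \<Longrightarrow> B \<in> sets M" for B
    by (simp add: null_sets_def sets_M m.sets_M)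
  have [measurable]: "N \<in> sets M" using N by (rule sets)
  \<comment> \<open>The restrictions of \<open>M\<close> to \<open>N\<close> and to its complement, kept as measures on the whole circle.\<close>
  define \<sigma> where "\<sigma> = density M (\<lambda>t. ennreal (indicator N t))"
  define \<rho> where "\<rho> = density M (\<lambda>t. ennreal (indicator (space M - N) t))"
  have em_\<sigma>: "emeasure \<sigma> A = emeasure M (A \<inter> N)" if "A \<in> sets M" for A
    using that unfolding \<sigma>_def by (simp add: ennreal_indicator emeasure_restricted Int_commute)
  have em_\<rho>: "emeasure \<rho> A = emeasure M (A - N)" if "A \<in> sets M" for A
  proof -
    have "emeasure \<rho> A = emeasure M ((space M - N) \<inter> A)"
      using that unfolding \<rho>_def by (simp add: ennreal_indicator emeasure_restricted)
    also have "(space M - N) \<inter> A = A - N" using sets.sets_into_space[OF that] by blast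
    finally show ?thesis .
  qed
  have fin: "finite_measure \<sigma>" "finite_measure \<rho>"
    by (auto intro!: finite_measureI simp: em_\<sigma> em_\<rho> \<sigma>_def[THEN arg_cong[of _ _ space]] \<rho>_def[THEN arg_cong[of _ _ space]])
  have "emeasure \<sigma> (space \<sigma> - N) = 0"
  proof -
    have "(space M - N) \<inter> N = {}" by blast
    then show ?thesis using em_\<sigma>[of "space M - N"] by (simp add: \<sigma>_def)
  qed
  then have sing: "singular_circle_measure \<sigma>"
    unfolding singular_circle_measure_def mutually_singular_def
    using fin N sets[OF N] by (auto simp: \<sigma>_def sets_M null_sets_def intro!: bexI[of _ N])
  have ac: "absolutely_continuous circle_lebesgue \<rho>"
    unfolding absolutely_continuous_def
  proof
    fix A assume A: "A \<in> null_sets circle_lebesgue"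
    have "measure M (A \<union> N) = measure M N + measure M (A - N)"
      using sets[OF A] by (subst finite_measure_Union[symmetric]) (auto intro!: arg_cong[of _ _ "measure M"])
    then have "measure M (A - N) \<le> 0" using max[OF null_sets.Un[OF A N]] by simp
    then have "emeasure M (A - N) = 0" using measure_nonneg[of M "A - N"] by (simp add: emeasure_eq_measure)
    then show "A \<in> null_sets \<rho>" using sets[OF A] em_\<rho>[OF sets[OF A]] by (simp add: null_sets_def \<rho>_def)
  qed
  have sets_\<rho>: "sets \<rho> = sets circle_lebesgue" by (simp add: \<rho>_def sets_M m.sets_M)
  from m.real_RN_deriv[OF fin(2) ac sets_\<rho>] obtain D where
    D: "D \<in> borel_measurable circle_lebesgue" "AE x in circle_lebesgue. RN_deriv circle_lebesgue \<rho> x = ennreal (D x)"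
       "\<And>x. 0 \<le> D x" by metis
  have \<rho>_eq: "\<rho> = density circle_lebesgue (\<lambda>t. ennreal (D t))"
    using m.density_RN_deriv[OF ac sets_\<rho>] density_cong[OF _ _ D(2)] D(1) by simp
  have intD: "integrable circle_lebesgue D"
  proof -
    interpret r: finite_measure \<rho> by fact
    have "integrable \<rho> (\<lambda>_. 1 :: real)" by simp
    then show ?thesis unfolding \<rho>_eq using D by (subst (asm) integrable_density) auto
  qed
  show thesis
  proof (rule that[OF sing intD])
    fix f :: "complex \<Rightarrow> complex" assume f: "continuous_on unit_circle f"
    have [measurable]: "f \<in> borel_measurable M" "f \<in> borel_measurable circle_lebesgue"
      using f by (auto intro: m.borel_measurable_continuous)
    have intf: "integrable M f" by (rule integrable_continuous[OF f])
    have "(\<integral>t. f t \<partial>M) = (\<integral>t. indicator N t *\<^sub>R f t + indicator (space M - N) t *\<^sub>R f t \<partial>M)"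
      by (intro Bochner_Integration.integral_cong) (auto split: split_indicator)
    also have "\<dots> = (\<integral>t. indicator N t *\<^sub>R f t \<partial>M) + (\<integral>t. indicator (space M - N) t *\<^sub>R f t \<partial>M)"
      by (intro Bochner_Integration.integral_add integrable_mult_indicator intf) auto
    also have "(\<integral>t. indicator N t *\<^sub>R f t \<partial>M) = (\<integral>t. f t \<partial>\<sigma>)"
      unfolding \<sigma>_def by (subst integral_density) auto
    also have "(\<integral>t. indicator (space M - N) t *\<^sub>R f t \<partial>M) = (\<integral>t. f t \<partial>\<rho>)"
      unfolding \<rho>_def by (subst integral_density) auto
    also have "(\<integral>t. f t \<partial>\<rho>) = (\<integral>t. D t *\<^sub>R f t \<partial>circle_lebesgue)"
      unfolding \<rho>_eq using D by (subst integral_density) auto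
    finally show "(\<integral>t. f t \<partial>M) = (\<integral>t. f t \<partial>\<sigma>) + (\<integral>t. f t * of_real (D t) \<partial>circle_lebesgue)"
      by (simp add: scaleR_conv_of_real mult.commute)
  qed
qed

text \<open>
  Herglotz's theorem is applied to \<open>H + 1\<close>, whose real part is positive at the origin also when \<open>H\<close>
  is an imaginary constant.  The added 1 is the Schwarz integral of Lebesgue measure itself, so it
  is absorbed in the absolutely continuous part, and the logarithm of the outer factor's boundary
  modulus is \<open>1 - D\<close>.
\<close>
theorem singular_part_exists:
  assumes hol: "H holomorphic_on unit_disk" and nn: "\<And>z. z \<in> unit_disk \<Longrightarrow> 0 \<le> Re (H z)"
    and \<alpha>: "cmod \<alpha> = 1" and F: "\<And>z. z \<in> unit_disk \<Longrightarrow> F z = \<alpha> * exp (- H z)"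
  shows "\<exists>S. is_singular_part F S"
proof -
  have hol1: "(\<lambda>z. H z + 1) holomorphic_on unit_disk" by (intro holomorphic_intros hol)
  have nn1: "0 \<le> Re (H z + 1)" if "z \<in> unit_disk" for z using nn[OF that] by simp
  have pos1: "0 < Re (H 0 + 1)" using nn[of 0] by simp
  obtain \<nu> where \<nu>: "circle_measure \<nu>"
    and H: "\<And>z. z \<in> unit_disk \<Longrightarrow> H z + 1 = (\<integral>t. (t + z) / (t - z) \<partial>\<nu>) + \<i> * of_real (Im (H 0 + 1))"
    using herglotz_representation[OF hol1 nn1 pos1] by blast
  obtain \<sigma> D where \<sigma>: "singular_circle_measure \<sigma>" and D: "integrable circle_lebesgue (D :: complex \<Rightarrow> real)"
    and dec: "\<And>f :: complex \<Rightarrow> complex. continuous_on unit_circle f \<Longrightarrow>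
       (\<integral>t. f t \<partial>\<nu>) = (\<integral>t. f t \<partial>\<sigma>) + (\<integral>t. f t * of_real (D t) \<partial>circle_lebesgue)"
    using circle_measure.lebesgue_decomposition[OF \<nu>] by blast
  define \<alpha>' where "\<alpha>' = \<alpha> * exp (- (\<i> * of_real (Im (H 0))))"
  have \<alpha>': "cmod \<alpha>' = 1" using \<alpha> by (simp add: \<alpha>'_def norm_mult)
  define \<psi> where "\<psi> = (\<lambda>t. exp (1 - D t))"
  define g where "g z = exp (\<integral>t. (t + z) / (t - z) * of_real (ln (\<psi> t)) \<partial>circle_lebesgue)" for z
  have "outer_function g"
    unfolding outer_function_def
  proof (intro exI[of _ 1] exI[of _ \<psi>] conjI ballI)
    show "\<psi> \<in> borel_measurable circle_lebesgue" using D by (simp add: \<psi>_def)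
    show "integrable circle_lebesgue (\<lambda>t. ln (\<psi> t))" using D by (simp add: \<psi>_def)
  qed (simp_all add: \<psi>_def g_def)
  moreover have "blaschke_product (\<lambda>_. 1)"
    unfolding blaschke_product_def
    by (intro exI[of _ 0] exI[of _ "{}"] exI[of _ "\<lambda>_. 0"]) simp
  moreover have "singular_inner (singular_fun \<alpha>' \<sigma>)"
    unfolding singular_inner_def using \<alpha>' \<sigma> by blast
  moreover have "F z = 1 * singular_fun \<alpha>' \<sigma> z * g z" if z: "z \<in> unit_disk" for z
  proof -
    let ?k = "\<lambda>t. (t + z) / (t - z)"
    have "(\<integral>t. ?k t * of_real (ln (\<psi> t)) \<partial>circle_lebesgue) = (\<integral>t. ?k t - ?k t * of_real (D t) \<partial>circle_lebesgue)"
      by (simp add: \<psi>_def right_diff_distrib)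
    also have "\<dots> = 1 - (\<integral>t. ?k t * of_real (D t) \<partial>circle_lebesgue)"
      using m.integrable_schwarz_kernel[OF z] integrable_schwarz_density[OF D z] schwarz_integral_lebesgue[OF z]
      by (subst Bochner_Integration.integral_diff) auto
    also have "\<dots> = (\<integral>t. ?k t \<partial>\<sigma>) + \<i> * of_real (Im (H 0)) - H z"
      using H[OF z] dec[OF continuous_on_schwarz_kernel[OF z]] by (simp add: algebra_simps)
    finally have "g z = exp ((\<integral>t. ?k t \<partial>\<sigma>) + \<i> * of_real (Im (H 0)) - H z)" by (simp only: g_def)
    then have "1 * singular_fun \<alpha>' \<sigma> z * g z = \<alpha> * (exp (- (\<i> * of_real (Im (H 0)))) * exp (- (\<integral>t. ?k t \<partial>\<sigma>))
      * exp ((\<integral>t. ?k t \<partial>\<sigma>) + \<i> * of_real (Im (H 0)) - H z))"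
      by (simp only: singular_fun_def \<alpha>'_def mult_1_left mult.assoc)
    also have "\<dots> = F z" unfolding exp_add[symmetric] F[OF z] by simp
    finally show ?thesis by simp
  qed
  ultimately show ?thesis unfolding is_singular_part_def by blast
qed

section \<open>The factorization of a nonvanishing function\<close>

lemma blaschke_factor_minus_1:
  assumes "a \<in> unit_disk - {0}" "z \<in> unit_disk"
  shows "cmod (blaschke_factor a z - 1) \<le> (1 - cmod a) * (2 / (1 - cmod z))"
proof -
  have "cmod (cnj a * z) \<le> 1 * cmod z"
    unfolding norm_mult complex_mod_cnj using assms by (intro mult_right_mono) auto
  then have far: "1 - cmod z \<le> cmod (1 - cnj a * z)"
    using norm_triangle_ineq2[of 1 "cnj a * z"] by simp
  then have nz: "1 - cnj a * z \<noteq> 0" "a \<noteq> 0" using assms by auto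
  have sq: "cnj a * a = of_real (cmod a) * of_real (cmod a)"
    using complex_norm_square[of a] by (simp add: power2_eq_square mult.commute[of a])
  have "blaschke_factor a z - 1
      = (of_real (cmod a) * (a - z) - a * (1 - cnj a * z)) / (a * (1 - cnj a * z))"
  proof -
    have "a * (1 - cnj a * z) / (a * (1 - cnj a * z)) = 1" using nz by simp
    then show ?thesis
      unfolding blaschke_factor_def times_divide_times_eq by (simp only: diff_divide_distrib)
  qed
  also have "of_real (cmod a) * (a - z) - a * (1 - cnj a * z)
      = of_real (cmod a - 1) * (a + of_real (cmod a) * z)"
    using arg_cong[OF sq, of "\<lambda>x. x * z"] by (simp add: algebra_simps)
  finally have "cmod (blaschke_factor a z - 1)
      = (1 - cmod a) * (cmod (a + of_real (cmod a) * z) / cmod a / cmod (1 - cnj a * z))"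
    using assms by (simp add: norm_mult norm_divide del: of_real_diff)
  also have "\<dots> \<le> (1 - cmod a) * (2 / (1 - cmod z))"
  proof (intro mult_left_mono frac_le)
    have "cmod (a + of_real (cmod a) * z) \<le> cmod a + cmod a * cmod z"
      using norm_triangle_ineq[of a "of_real (cmod a) * z"] by (simp add: norm_mult)
    also have "\<dots> \<le> cmod a * 2" using assms by (simp add: mult_left_mono)
    finally show "cmod (a + of_real (cmod a) * z) / cmod a \<le> 2"
      using assms by (simp add: field_simps)
  qed (use assms far in auto)
  finally show ?thesis .
qed

text \<open>
  The summability condition makes the product converge at each of the prescribed zeros, so it really
  vanishes there; a product without zeros therefore has no factors.
\<close>
lemma blaschke_product_nonvanishing:
  assumes "blaschke_product B" and nz: "\<And>z. z \<in> unit_disk \<Longrightarrow> B z \<noteq> 0" and "z \<in> unit_disk"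
  shows "B z = 1"
proof -
  obtain m J a where a: "a ` J \<subseteq> unit_disk - {0}" "(\<lambda>n. 1 - cmod (a n)) summable_on J"
    and B: "\<And>z. z \<in> unit_disk \<Longrightarrow> B z = z ^ m * (\<Prod>n. if n \<in> J then blaschke_factor (a n) z else 1)"
    using assms(1) unfolding blaschke_product_def by blast
  have "J = {}"
  proof (rule ccontr)
    assume "J \<noteq> {}"
    then obtain k where k: "k \<in> J" by blast
    define f where "f n = (if n \<in> J then blaschke_factor (a n) (a k) else 1)" for n
    have ak: "a k \<in> unit_disk" using a k by blast
    have "(\<lambda>n. if n \<in> J then 1 - cmod (a n) else 0) summable_on UNIV"
      using a(2) by (rule summable_on_cong_neutral[THEN iffD1, rotated -1]) auto
    then have "summable (\<lambda>n. if n \<in> J then 1 - cmod (a n) else 0)"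
      by (subst (asm) summable_on_UNIV_nonneg_real_iff) (use a in \<open>auto simp: image_subset_iff less_imp_le\<close>)
    then have "summable (\<lambda>n. (if n \<in> J then 1 - cmod (a n) else 0) * (2 / (1 - cmod (a k))))"
      by (rule summable_mult2)
    then have "summable (\<lambda>n. norm (f n - 1))"
    proof (rule summable_comparison_test', simp only: real_norm_def abs_norm_cancel)
      fix n show "norm (f n - 1) \<le> (if n \<in> J then 1 - cmod (a n) else 0) * (2 / (1 - cmod (a k)))"
      proof (cases "n \<in> J")
        case True
        then have "a n \<in> unit_disk - {0}" using a(1) by blast
        from blaschke_factor_minus_1[OF this ak] show ?thesis using True by (simp add: f_def)
      qed (simp add: f_def)
    qed
    then have "f has_prod prodinf f"
      by (intro convergent_prod_has_prod abs_convergent_prod_imp_convergent_prod)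
         (simp add: abs_convergent_prod_conv_summable)
    moreover have "f k = 0" using k by (simp add: f_def blaschke_factor_def)
    ultimately have "prodinf f = 0" by (rule has_prod_zeroI)
    then have "B (a k) = 0" using B[OF ak] by (simp add: f_def[abs_def])
    then show False using nz[OF ak] by simp
  qed
  then have B': "B z = z ^ m" if "z \<in> unit_disk" for z using B[OF that] by simp
  have "m = 0" using B'[of 0] nz[of 0] by (cases m) auto
  then show ?thesis using B' assms(3) by simp
qed

lemma singular_circle_measureD: "singular_circle_measure \<mu> \<Longrightarrow> circle_measure \<mu>"
  by (simp add: singular_circle_measure_def circle_measure_def circle_measure_axioms_def)

lemma null_carrier:
  assumes "singular_circle_measure \<mu>"
  obtains N where "N \<in> null_sets circle_lebesgue" "emeasure \<mu> (unit_circle - N) = 0"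
  using assms circle_measure.space_M[OF singular_circle_measureD[OF assms]]
  unfolding singular_circle_measure_def mutually_singular_def null_sets_def by auto

text \<open>
  Inner regularity of finite Borel measures on the plane, applied to the image of \<open>M\<close> under the
  inclusion of the circle.
\<close>
lemma (in circle_measure) compact_approx:
  assumes "E \<in> sets M" "0 < e"
  obtains K where "compact K" "K \<subseteq> E" "measure M E \<le> measure M K + e"
proof -
  let ?M' = "distr M borel (\<lambda>x. x)"
  have id: "(\<lambda>x. x) \<in> measurable M borel" by (intro borel_measurable_continuous continuous_intros)
  have E: "E \<in> sets borel" "E \<subseteq> unit_circle"
    using assms(1) unfolding sets_M circle_borel_def by (auto simp: sets_restrict_space)
  interpret M': finite_measure ?M' by (rule finite_measure_distr[OF id])
  have eq: "emeasure ?M' A = emeasure M A" if "A \<in> sets borel" "A \<subseteq> unit_circle" for A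
    using that by (simp add: emeasure_distr[OF id] Int_absorb2 space_M)
  have inner: "emeasure ?M' E = (SUP K \<in> {K. K \<subseteq> E \<and> compact K}. emeasure ?M' K)"
    by (rule inner_regular) (use E M'.emeasure_finite in auto)
  have "\<exists>K. K \<subseteq> E \<and> compact K \<and> measure M E - e < measure M K"
  proof (rule ccontr)
    assume H: "\<not> ?thesis"
    have "emeasure ?M' E \<le> ennreal (measure M E - e)"
      unfolding inner
    proof (rule SUP_least)
      fix K assume "K \<in> {K. K \<subseteq> E \<and> compact K}"
      then have K: "K \<subseteq> E" "compact K" "measure M K \<le> measure M E - e" using H by (auto simp: not_less)
      then have "emeasure ?M' K = ennreal (measure M K)"
        using E by (subst eq) (auto simp: compact_imp_closed emeasure_eq_measure)
      then show "emeasure ?M' K \<le> ennreal (measure M E - e)" using K by (simp add: ennreal_leI)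
    qed
    then have le: "ennreal (measure M E) \<le> ennreal (measure M E - e)" by (simp add: eq[OF E] emeasure_eq_measure)
    have "measure M {} \<le> measure M E - e" using H compact_empty by (metis empty_subsetI not_less)
    then have "0 \<le> measure M E - e" by simp
    then show False using le \<open>0 < e\<close> by (simp add: ennreal_le_iff)
  qed
  then show thesis using that by force
qed

lemma cmod_singular_fun:
  assumes "cmod \<alpha> = 1" "circle_measure \<mu>" "z \<in> unit_disk"
  shows "cmod (singular_fun \<alpha> \<mu> z) = exp (- (\<integral>t. poisson_kernel z t \<partial>\<mu>))"
  using assms circle_measure.Re_schwarz_integral[OF assms(2,3)] by (simp add: singular_fun_def norm_mult)

lemma singular_fun_nonzero: "cmod \<alpha> = 1 \<Longrightarrow> singular_fun \<alpha> \<mu> z \<noteq> 0"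
  by (auto simp: singular_fun_def)

lemma holomorphic_singular_fun:
  "circle_measure \<mu> \<Longrightarrow> singular_fun \<alpha> \<mu> holomorphic_on unit_disk"
  unfolding singular_fun_def by (intro holomorphic_intros circle_measure.holomorphic_schwarz_integral)

text \<open>
  The function \<open>u\<close> is the logarithm of the boundary modulus of the outer factor.
\<close>
lemma nonvanishing_factorization:
  assumes S: "is_singular_part F S" and nz: "\<And>z. z \<in> unit_disk \<Longrightarrow> F z \<noteq> 0"
  obtains \<alpha> \<sigma> u where "cmod \<alpha> = 1" "singular_circle_measure \<sigma>" "integrable circle_lebesgue (u :: complex \<Rightarrow> real)"
    "\<And>z. z \<in> unit_disk \<Longrightarrow> S z = singular_fun \<alpha> \<sigma> z"
    "\<And>z. z \<in> unit_disk \<Longrightarrow> cmod (F z) = cmod (S z) * exp (\<integral>t. poisson_kernel z t * u t \<partial>circle_lebesgue)"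
proof -
  obtain \<alpha> \<sigma> where S': "cmod \<alpha> = 1" "singular_circle_measure \<sigma>" "\<And>z. z \<in> unit_disk \<Longrightarrow> S z = singular_fun \<alpha> \<sigma> z"
    using S unfolding is_singular_part_def singular_inner_def by blast
  obtain B g where B: "blaschke_product B" and g: "outer_function g"
    and F: "\<And>z. z \<in> unit_disk \<Longrightarrow> F z = B z * S z * g z"
    using S unfolding is_singular_part_def by blast
  have B1: "B z = 1" if "z \<in> unit_disk" for z
    using blaschke_product_nonvanishing[OF B _ that] F nz by (metis mult_eq_0_iff)
  obtain \<beta> \<psi> where \<psi>: "cmod \<beta> = 1" "integrable circle_lebesgue (\<lambda>t. ln (\<psi> t))"
    "\<And>z. z \<in> unit_disk \<Longrightarrow> g z = \<beta> * exp (\<integral>t. (t + z) / (t - z) * of_real (ln (\<psi> t)) \<partial>circle_lebesgue)"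
    using g unfolding outer_function_def by blast
  show thesis
  proof (rule that[OF S'(1,2) \<psi>(2) S'(3)])
    fix z assume z: "z \<in> unit_disk"
    note Re_schwarz_density[OF \<psi>(2) z]
    then show "cmod (F z) = cmod (S z) * exp (\<integral>t. poisson_kernel z t * ln (\<psi> t) \<partial>circle_lebesgue)"
      using F[OF z] B1[OF z] \<psi>(1) \<psi>(3)[OF z] by (simp add: norm_mult)
  qed
qed

section \<open>Comparing singular parts\<close>

text \<open>
  On a compact set \<open>K\<close> with \<open>\<sigma> K = 0\<close>, the comparison of the zero measure with \<open>\<sigma> - u dm\<close> gives
  \<open>0 \<le> - \<integral>\<^sub>K u dm\<close>.  Such sets exhaust \<open>{u > 0}\<close> up to a null set, because \<open>\<sigma>\<close> is singular.
\<close>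
lemma outer_exponent_nonpos:
  assumes \<sigma>: "singular_circle_measure \<sigma>" and u: "integrable circle_lebesgue (u :: complex \<Rightarrow> real)"
    and le: "\<And>z. z \<in> unit_disk \<Longrightarrow>
      (\<integral>t. poisson_kernel z t * u t \<partial>circle_lebesgue) \<le> (\<integral>t. poisson_kernel z t \<partial>\<sigma>)"
  shows "AE t in circle_lebesgue. u t \<le> 0"
proof -
  interpret s: circle_measure \<sigma> by (rule singular_circle_measureD[OF \<sigma>])
  obtain N where N: "N \<in> null_sets circle_lebesgue" "emeasure \<sigma> (unit_circle - N) = 0"
    by (rule null_carrier[OF \<sigma>])
  have Nsets [measurable]: "N \<in> sets circle_lebesgue" using N(1) by (rule null_setsD2)
  have [measurable]: "u \<in> borel_measurable circle_lebesgue" using u by simp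
  define E where "E = {t \<in> space circle_lebesgue. 0 < u t} - N"
  have E: "E \<in> sets circle_lebesgue" unfolding E_def by measurable
  have zero: "measure circle_lebesgue E = 0"
  proof (rule ccontr)
    assume "measure circle_lebesgue E \<noteq> 0"
    then have "0 < measure circle_lebesgue E / 2" using measure_nonneg[of circle_lebesgue E] by linarith
    \<comment> \<open>A compact part of \<open>E\<close> of positive measure suffices for a contradiction.\<close>
    from m.compact_approx[OF E this] obtain K where K: "compact K" "K \<subseteq> E"
      "measure circle_lebesgue E \<le> measure circle_lebesgue K + measure circle_lebesgue E / 2" by blast
    have KT: "K \<subseteq> unit_circle" using K(2) by (auto simp: E_def m.space_M)
    have "K \<subseteq> unit_circle - N" using K(2) KT by (auto simp: E_def)
    then have "emeasure \<sigma> K \<le> 0"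
      using N(2) Nsets by (metis emeasure_mono sets.compl_sets s.space_M s.sets_M m.sets_M)
    then have \<sigma>K: "measure \<sigma> K = 0" by (simp add: measure_def)
    \<comment> \<open>The hypothesis is a comparison of the zero measure with \<open>\<sigma> - u dm\<close>.\<close>
    have zero': "measure (null_measure circle_lebesgue) K \<le> measure \<sigma> K + (\<integral>t. indicator K t * (- u t) \<partial>circle_lebesgue) + 0"
    proof (rule measure_le_of_poisson_integral_le[where w = "\<lambda>_. 0"])
      show "circle_measure (null_measure circle_lebesgue)"
        by (intro circle_measure.intro circle_measure_axioms.intro finite_measureI) (auto simp: m.sets_M)
      show "circle_measure \<sigma>" by (rule s.circle_measure_axioms)
      fix z assume "z \<in> unit_disk"
      from le[OF this] show "(\<integral>t. poisson_kernel z t \<partial>null_measure circle_lebesgue)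
        \<le> (\<integral>t. poisson_kernel z t \<partial>\<sigma>) + (\<integral>t. poisson_kernel z t * - u t \<partial>circle_lebesgue) + 0" by simp
    qed (use u K KT in auto)
    have Ks: "K \<in> sets circle_lebesgue" using K(1) KT by (intro m.borel_set_M) (auto simp: compact_imp_closed)
    have int: "integrable circle_lebesgue (\<lambda>t. indicator K t * u t)"
      using integrable_mult_indicator[OF Ks u] by simp
    have nn: "AE t in circle_lebesgue. 0 \<le> indicator K t * u t"
      using K(2) by (intro AE_I2) (auto simp: E_def split: split_indicator)
    have "(\<integral>t. indicator K t * u t \<partial>circle_lebesgue) = 0"
      using zero' \<sigma>K integral_nonneg_AE[OF nn] by simp
    then have "AE t in circle_lebesgue. indicator K t * u t = 0"
      using integral_nonneg_eq_0_iff_AE[OF int nn] by simp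
    then have "AE t in circle_lebesgue. t \<notin> K"
      by (rule eventually_mono) (use K(2) in \<open>auto simp: E_def split: split_indicator_asm\<close>)
    then have "measure circle_lebesgue K = 0"
      using Ks by (simp add: AE_iff_null_sets[symmetric] measure_eq_0_null_sets)
    then show False using K(3) \<open>0 < measure circle_lebesgue E / 2\<close> by simp
  qed
  then have "E \<in> null_sets circle_lebesgue" using E by (simp add: null_sets_def m.emeasure_eq_measure)
  then have "AE t in circle_lebesgue. t \<notin> E" "AE t in circle_lebesgue. t \<notin> N"
    using N(1) AE_not_in by blast+
  then show ?thesis using AE_space by eventually_elim (auto simp: E_def not_less)
qed

lemma Hardy_means_bounded:
  assumes "f \<in> Hardy p"
  obtains C where
    "\<And>r. 0 < r \<Longrightarrow> r < 1 \<Longrightarrow> (\<integral>t. cmod (f (of_real r * t)) powr p \<partial>circle_lebesgue) \<le> C"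
proof -
  have "bdd_above ((\<lambda>r. \<integral>t. cmod (f (of_real r * t)) powr p \<partial>circle_lebesgue) ` {0<..<1})"
    using assms by (simp add: Hardy_def)
  then obtain C where
    "\<forall>x \<in> (\<lambda>r. \<integral>t. cmod (f (of_real r * t)) powr p \<partial>circle_lebesgue) ` {0<..<1}. x \<le> C"
    unfolding bdd_above_def by blast
  then show thesis by (intro that[of C]) auto
qed

text \<open>
  The bound behind the uniform integrability of \<open>ln\<^sup>+ \<bar>f\<bar>\<close> over circles, for \<open>f\<close> in a Hardy space:
  apply \<open>ln y \<le> y - 1\<close> to a multiple of \<open>x\<^sup>p\<close>.
\<close>
lemma log_le_powr:
  fixes p e :: real
  assumes "0 < p" "0 < e"
  obtains A where "\<And>x. 0 < x \<Longrightarrow> ln x \<le> A + e * x powr p"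
proof -
  show thesis
  proof (rule that)
    fix x :: real assume x: "0 < x"
    have "ln (e * p * x powr p) \<le> e * p * x powr p"
      using assms x by (intro order_trans[OF ln_le_minus_one]) auto
    then have "ln (e * p) + p * ln x \<le> e * p * x powr p"
      using assms x by (simp add: ln_mult ln_powr)
    then have "ln x \<le> (e * p * x powr p - ln (e * p)) / p"
      using assms by (simp add: pos_le_divide_eq mult.commute)
    also have "\<dots> = - ln (e * p) / p + e * x powr p"
      using assms by (simp add: diff_divide_distrib)
    finally show "ln x \<le> - ln (e * p) / p + e * x powr p" .
  qed
qed

text \<open>
  The hypothesis \<open>eq\<close> says that \<open>f\<close> is, up to a unimodular constant, the function with singular
  data \<open>\<sigma>\<close> and outer data \<open>- u\<close> divided by \<open>S\<^sub>\<mu>\<close>.  Membership in \<open>H\<^sup>p\<close> excludes a singular part of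
  the wrong sign: on null sets only \<open>ln \<bar>f\<bar> \<le> A + \<epsilon> \<bar>f\<bar>\<^sup>p\<close> matters, and its means on circles are
  bounded by an arbitrarily small quantity apart from the density \<open>A\<close>.
\<close>
lemma singular_measure_le_of_Hardy_quotient:
  assumes p: "0 < p" and \<mu>: "singular_circle_measure \<mu>" and \<sigma>: "singular_circle_measure \<sigma>"
    and u: "integrable circle_lebesgue (u :: complex \<Rightarrow> real)" and f: "f \<in> Hardy p"
    and nz: "\<And>z. z \<in> unit_disk \<Longrightarrow> f z \<noteq> 0"
    and eq: "\<And>z. z \<in> unit_disk \<Longrightarrow> (\<integral>t. poisson_kernel z t \<partial>\<mu>)
      = (\<integral>t. poisson_kernel z t \<partial>\<sigma>) + (\<integral>t. poisson_kernel z t * u t \<partial>circle_lebesgue) + ln (cmod (f z))"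
  shows "\<And>E. emeasure \<mu> E \<le> emeasure \<sigma> E"
proof -
  interpret \<mu>: circle_measure \<mu> by (rule singular_circle_measureD[OF \<mu>])
  interpret s: circle_measure \<sigma> by (rule singular_circle_measureD[OF \<sigma>])
  obtain N where N: "N \<in> null_sets circle_lebesgue" "emeasure \<mu> (unit_circle - N) = 0"
    by (rule null_carrier[OF \<mu>])
  have NT: "N \<subseteq> unit_circle" using sets.sets_into_space[OF null_setsD2[OF N(1)]] by (simp add: m.space_M)
  have sets_eq: "sets \<mu> = sets circle_lebesgue" "sets \<sigma> = sets circle_lebesgue"
    by (simp_all add: \<mu>.sets_M s.sets_M m.sets_M)
  have fhol: "f holomorphic_on unit_disk" using f by (simp add: Hardy_def)
  obtain C where C: "\<And>r. 0 < r \<Longrightarrow> r < 1 \<Longrightarrow> (\<integral>t. cmod (f (of_real r * t)) powr p \<partial>circle_lebesgue) \<le> C"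
    using Hardy_means_bounded[OF f] by blast
  have C0: "0 \<le> C"
    by (rule order_trans[OF _ C[of "1/2"]]) (auto intro: integral_nonneg_AE)
  have cont: "continuous_on unit_disk (\<lambda>z. cmod (f z) powr p)"
    by (rule continuous_on_powr')
       (use p in \<open>auto intro!: continuous_intros holomorphic_on_imp_continuous_on fhol\<close>)
  have compact_null: "measure \<mu> K \<le> measure \<sigma> K" if K: "compact K" "K \<subseteq> N" for K
  proof (rule field_le_epsilon)
    fix e :: real assume "0 < e"
    \<comment> \<open>The weight of the \<open>p\<close>-th power is chosen so that its total contribution is at most \<open>e\<close>.\<close>
    define e' where "e' = e / (C + 1)"
    have e': "0 < e'" "e' * C \<le> e" using \<open>0 < e\<close> C0 by (auto simp: e'_def field_simps)
    obtain A where A: "\<And>x. 0 < x \<Longrightarrow> ln x \<le> A + e' * x powr p" using log_le_powr[OF p e'(1)] by blast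
    have KT: "K \<subseteq> unit_circle" using K(2) NT by blast
    have "measure \<mu> K \<le> measure \<sigma> K + (\<integral>t. indicator K t * (u t + A) \<partial>circle_lebesgue) + e' * C"
    proof (rule measure_le_of_poisson_integral_le[where w = "\<lambda>z. e' * cmod (f z) powr p"])
      show "integrable circle_lebesgue (\<lambda>t. u t + A)" using u by simp
      show "continuous_on unit_disk (\<lambda>z. e' * cmod (f z) powr p)" by (intro continuous_on_mult continuous_on_const cont)
      show "0 \<le> e' * cmod (f z) powr p" for z using e' by simp
      show "(\<integral>t. e' * cmod (f (of_real r * t)) powr p \<partial>circle_lebesgue) \<le> e' * C" if "0 < r" "r < 1" for r
        using C[OF that] e' by simp
      fix z assume z: "z \<in> unit_disk"
      have "(\<integral>t. poisson_kernel z t * (u t + A) \<partial>circle_lebesgue)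
        = (\<integral>t. poisson_kernel z t * u t \<partial>circle_lebesgue) + A"
      proof -
        note integrable_poisson_density[OF u z]
        moreover have "integrable circle_lebesgue (\<lambda>t. poisson_kernel z t * A)"
          by (intro m.integrable_continuous continuous_intros z)
        ultimately show ?thesis using poisson_integral_lebesgue[OF z] by (simp add: distrib_left)
      qed
      then show "(\<integral>t. poisson_kernel z t \<partial>\<mu>) \<le> (\<integral>t. poisson_kernel z t \<partial>\<sigma>)
        + (\<integral>t. poisson_kernel z t * (u t + A) \<partial>circle_lebesgue) + e' * cmod (f z) powr p"
        using eq[OF z] A[of "cmod (f z)"] nz[OF z] by simp
    qed (use K KT \<mu>.circle_measure_axioms s.circle_measure_axioms in auto)
    also have "(\<integral>t. indicator K t * (u t + A) \<partial>circle_lebesgue) = 0"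
    proof (rule integral_eq_zero_AE)
      show "AE t in circle_lebesgue. indicator K t * (u t + A) = 0"
        using AE_not_in[OF N(1)] by eventually_elim (use K(2) in \<open>auto split: split_indicator\<close>)
    qed
    finally show "measure \<mu> K \<le> measure \<sigma> K + e" using e' by simp
  qed
  show "emeasure \<mu> E \<le> emeasure \<sigma> E" for E
  proof (cases "E \<in> sets \<mu>")
    case True
    have EN: "E \<inter> N \<in> sets \<mu>" using True N(1) by (auto simp: sets_eq null_setsD2)
    have "measure \<mu> (E \<inter> N) \<le> measure \<sigma> E"
    proof (rule field_le_epsilon)
      fix e :: real assume "0 < e"
      from \<mu>.compact_approx[OF EN this] obtain K where
        K: "compact K" "K \<subseteq> E \<inter> N" "measure \<mu> (E \<inter> N) \<le> measure \<mu> K + e" by blast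
      have "measure \<mu> K \<le> measure \<sigma> K" using K by (intro compact_null) auto
      also have "\<dots> \<le> measure \<sigma> E"
        using K True by (intro s.finite_measure_mono) (auto simp: sets_eq)
      finally show "measure \<mu> (E \<inter> N) \<le> measure \<sigma> E + e" using K(3) by simp
    qed
    moreover have "emeasure \<mu> E \<le> emeasure \<mu> (E \<inter> N) + emeasure \<mu> (unit_circle - N)"
    proof -
      have "unit_circle - N \<in> sets \<mu>"
        using sets.compl_sets[OF null_setsD2[OF N(1)]] by (simp add: m.space_M sets_eq)
      then have "emeasure \<mu> (E \<inter> N \<union> (unit_circle - N)) \<le> emeasure \<mu> (E \<inter> N) + emeasure \<mu> (unit_circle - N)"
        using EN by (intro emeasure_subadditive)
      moreover have "emeasure \<mu> E \<le> emeasure \<mu> (E \<inter> N \<union> (unit_circle - N))"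
        using EN \<open>unit_circle - N \<in> sets \<mu>\<close> sets.sets_into_space[OF True]
        by (intro emeasure_mono) (auto simp: \<mu>.space_M)
      ultimately show ?thesis by (rule order_trans[rotated])
    qed
    ultimately show ?thesis using N(2)
      by (simp add: \<mu>.emeasure_eq_measure s.emeasure_eq_measure)
  qed (simp add: emeasure_notin_sets)
qed

text \<open>
  The kernel is positive, so an inequality of measures passes to Poisson integrals.
\<close>
lemma poisson_integral_mono_measure:
  assumes "circle_measure \<mu>" "circle_measure \<sigma>" and le: "\<And>E. emeasure \<mu> E \<le> emeasure \<sigma> E" and z: "z \<in> unit_disk"
  shows "(\<integral>t. poisson_kernel z t \<partial>\<mu>) \<le> (\<integral>t. poisson_kernel z t \<partial>\<sigma>)"
proof -
  interpret \<mu>: circle_measure \<mu> by fact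
  interpret s: circle_measure \<sigma> by fact
  have sets: "sets \<mu> = sets \<sigma>" by (simp add: \<mu>.sets_M s.sets_M)
  have int: "integrable \<mu> (poisson_kernel z)" "integrable \<sigma> (poisson_kernel z)"
    by (intro \<mu>.integrable_continuous s.integrable_continuous continuous_intros z)+
  have nn: "AE t in \<mu>. 0 \<le> poisson_kernel z t" "AE t in \<sigma>. 0 \<le> poisson_kernel z t"
    using poisson_kernel_nonneg[OF z] by (auto intro!: AE_I2 simp: \<mu>.space_M s.space_M)
  have "ennreal (\<integral>t. poisson_kernel z t \<partial>\<mu>) = (\<integral>\<^sup>+t. ennreal (poisson_kernel z t) \<partial>\<mu>)"
    by (rule nn_integral_eq_integral[OF int(1) nn(1), symmetric])
  also have "\<dots> \<le> (\<integral>\<^sup>+t. ennreal (poisson_kernel z t) \<partial>\<sigma>)"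
  proof (rule nn_integral_mono_measure)
    show "\<mu> \<le> \<sigma>" using le by (simp add: le_measure[OF sets] le_fun_def)
  qed (simp add: sets)
  also have "\<dots> = ennreal (\<integral>t. poisson_kernel z t \<partial>\<sigma>)"
    by (rule nn_integral_eq_integral[OF int(2) nn(2)])
  finally show ?thesis using integral_nonneg_AE[OF nn(2)] by (simp add: ennreal_le_iff)
qed

section \<open>Composition and multiplication on Hardy spaces\<close>

text \<open>
  Poisson integrals of nonnegative continuous functions are harmonic: they are the real parts of
  Schwarz integrals of measures.
\<close>
lemma schwarz_integral_of_density:
  fixes h :: "complex \<Rightarrow> real"
  assumes h: "continuous_on unit_circle h" "\<And>t. t \<in> unit_circle \<Longrightarrow> 0 \<le> h t"
  obtains V where "V holomorphic_on unit_disk"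
    "\<And>z. z \<in> unit_disk \<Longrightarrow> Re (V z) = (\<integral>t. poisson_kernel z t * h t \<partial>circle_lebesgue)"
proof -
  let ?\<nu> = "density circle_lebesgue (\<lambda>t. ennreal (h t))"
  have int: "integrable circle_lebesgue h" by (rule m.integrable_continuous[OF h(1)])
  have nn: "AE t in circle_lebesgue. 0 \<le> h t" using h(2) by (intro AE_I2) (simp add: m.space_M)
  interpret \<nu>: circle_measure ?\<nu>
  proof (intro circle_measure.intro circle_measure_axioms.intro finite_measureI)
    show "emeasure ?\<nu> (space ?\<nu>) \<noteq> \<infinity>"
      using int nn by (simp add: emeasure_density nn_integral_eq_integral cong: nn_integral_cong)
  qed (simp add: m.sets_M)
  show thesis
  proof (rule that[OF \<nu>.holomorphic_schwarz_integral])
    fix z assume z: "z \<in> unit_disk"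
    have "(\<lambda>t. poisson_kernel z t) \<in> borel_measurable circle_lebesgue"
      by (intro m.borel_measurable_continuous continuous_intros z)
    then have "(\<integral>t. poisson_kernel z t \<partial>?\<nu>) = (\<integral>t. h t *\<^sub>R poisson_kernel z t \<partial>circle_lebesgue)"
      using int nn by (intro integral_density) auto
    then show "Re (\<integral>t. (t + z) / (t - z) \<partial>?\<nu>) = (\<integral>t. poisson_kernel z t * h t \<partial>circle_lebesgue)"
      unfolding \<nu>.Re_schwarz_integral[OF z] by (simp add: mult.commute)
  qed
qed

text \<open>
  Near a point where \<open>f\<close> does not vanish, \<open>\<bar>f\<bar>\<^sup>p = \<bar>k\<bar>\<close> for a holomorphic \<open>k\<close>.  Rotating \<open>k\<close> so
  that it is positive at \<open>a\<close>, and linearising \<open>\<bar>z\<bar>\<^sup>2\<close> around \<open>a\<close>, yields a holomorphic \<open>L\<close> whose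
  real part lies below the given function by \<open>\<epsilon> \<bar>z - a\<bar>\<^sup>2\<close>, up to a constant, with equality at
  \<open>a\<close>.  A maximum at \<open>a\<close> would thus be a strict maximum of \<open>\<bar>exp L\<bar>\<close>.
\<close>
lemma power_modulus_minus_harmonic_no_strict_max:
  fixes f V :: "complex \<Rightarrow> complex" and p \<epsilon> :: real
  assumes f: "f holomorphic_on ball a \<rho>" and V: "V holomorphic_on ball a \<rho>"
    and "0 < \<rho>" "0 < \<epsilon>" and nz: "f a \<noteq> 0"
    and max: "\<And>z. z \<in> ball a \<rho> \<Longrightarrow>
      cmod (f z) powr p - Re (V z) + \<epsilon> * (cmod z)\<^sup>2 \<le> cmod (f a) powr p - Re (V a) + \<epsilon> * (cmod a)\<^sup>2"
  shows False
proof -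
  have "continuous (at a) f"
    using holomorphic_on_imp_continuous_on[OF f] continuous_on_eq_continuous_at[OF open_ball]
      centre_in_ball \<open>0 < \<rho>\<close> by blast
  from continuous_at_avoid[OF this nz] obtain e where e: "e > 0" "\<And>y. dist a y < e \<Longrightarrow> f y \<noteq> 0" by auto
  define \<eta> where "\<eta> = min e \<rho>"
  have \<eta>: "0 < \<eta>" "ball a \<eta> \<subseteq> ball a \<rho>" "\<And>z. z \<in> ball a \<eta> \<Longrightarrow> f z \<noteq> 0"
    using e \<open>0 < \<rho>\<close> by (auto simp: \<eta>_def)
  obtain g where g: "g holomorphic_on ball a \<eta>" "\<And>z. z \<in> ball a \<eta> \<Longrightarrow> exp (g z) = f z"
    using holomorphic_logarithm_exists[of "ball a \<eta>" f a] holomorphic_on_subset[OF f \<eta>(2)] \<eta> by auto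
  define k where "k z = exp (of_real p * g z)" for z
  have k: "cmod (k z) = cmod (f z) powr p" if "z \<in> ball a \<eta>" for z
    using g(2)[OF that, symmetric] by (simp add: k_def powr_def)
  \<comment> \<open>The rotation that makes \<open>k\<close> positive at \<open>a\<close>.\<close>
  define u where "u = cnj (k a) / of_real (cmod (k a))"
  have ka: "k a \<noteq> 0" by (simp add: k_def)
  have u: "cmod u = 1" "u * k a = of_real (cmod (k a))"
    using ka by (simp_all add: u_def norm_divide mult.commute[of "cnj (k a)"] complex_norm_square[symmetric] power2_eq_square)
  define L where "L z = u * k z - V z + 2 * of_real \<epsilon> * cnj a * (z - a)" for z
  have L: "Re (L z) \<le> Re (L a) - \<epsilon> * (cmod (z - a))\<^sup>2" if z: "z \<in> ball a \<eta>" for z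
  proof -
    have "Re (u * k z) \<le> cmod (u * k z)" by (rule complex_Re_le_cmod)
    then have 1: "Re (u * k z) \<le> cmod (f z) powr p" using u k[OF z] by (simp add: norm_mult)
    have 2: "Re (u * k a) = cmod (f a) powr p" using u k[of a] \<eta>(1) by simp
    have 3: "(cmod z)\<^sup>2 = (cmod a)\<^sup>2 + 2 * Re (cnj a * (z - a)) + (cmod (z - a))\<^sup>2"
      unfolding cmod_power2 by (simp add: power2_eq_square algebra_simps)
    have 4: "Re (2 * of_real \<epsilon> * cnj a * (z - a)) = \<epsilon> * (2 * Re (cnj a * (z - a)))"
      by (simp add: algebra_simps)
    show ?thesis using max[of z] \<eta>(2) z 1 2 4 unfolding 3 L_def by (auto simp: distrib_left)
  qed
  have "(\<lambda>z. exp (L z)) constant_on ball a \<eta>"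
  proof (rule maximum_modulus_principle)
    show "(\<lambda>z. exp (L z)) holomorphic_on ball a \<eta>"
      unfolding L_def k_def by (intro holomorphic_intros g(1) holomorphic_on_subset[OF V \<eta>(2)])
    fix z assume "z \<in> ball a \<eta>"
    moreover have "0 \<le> \<epsilon> * (cmod (z - a))\<^sup>2" using \<open>0 < \<epsilon>\<close> by simp
    ultimately have "Re (L z) \<le> Re (L a)" using L[of z] by linarith
    then show "cmod (exp (L z)) \<le> cmod (exp (L a))" by simp
  qed (use \<eta> in auto)
  moreover define b where "b = a + of_real (\<eta> / 2)"
  have b: "b \<in> ball a \<eta>" "cmod (b - a) = \<eta> / 2" using \<eta>(1) by (auto simp: b_def dist_norm)
  ultimately have "exp (L b) = exp (L a)" using \<eta>(1) unfolding constant_on_def by auto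
  then have "Re (L b) = Re (L a)" by (metis exp_inj_iff norm_exp_eq_Re)
  then show False using L[OF b(1)] b(2) mult_pos_pos[OF \<open>0 < \<epsilon>\<close> zero_less_power[OF \<eta>(1), of 2]]
    by (simp add: field_simps)
qed

text \<open>
  If the difference of the two sides were \<open>\<delta> > 0\<close> somewhere, then after adding \<open>\<delta> \<bar>z\<bar>\<^sup>2 / 2\<close> it
  would have an interior maximum, as it tends to 0 at the boundary.  At the maximum \<open>f\<close> is nonzero,
  since the Poisson integral is nonnegative; this makes the argument work for all \<open>p > 0\<close>.
\<close>
lemma norm_powr_le_poisson_integral:
  assumes cont: "continuous_on (cball 0 1) f" and hol: "f holomorphic_on unit_disk"
    and p: "0 < p" and w: "w \<in> unit_disk"
  shows "cmod (f w) powr p \<le> (\<integral>t. poisson_kernel w t * cmod (f t) powr p \<partial>circle_lebesgue)"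
proof (rule ccontr)
  let ?h = "\<lambda>t. cmod (f t) powr p"
  let ?U = "\<lambda>z. \<integral>t. poisson_kernel z t * ?h t \<partial>circle_lebesgue"
  have conth: "continuous_on (cball 0 1) ?h"
    by (rule continuous_on_powr') (use p in \<open>auto intro!: continuous_intros cont\<close>)
  have contT: "continuous_on unit_circle ?h" by (rule continuous_on_subset[OF conth]) auto
  obtain V where V: "V holomorphic_on unit_disk" "\<And>z. z \<in> unit_disk \<Longrightarrow> Re (V z) = ?U z"
    by (rule schwarz_integral_of_density[OF contT]) auto
  have U_nn: "0 \<le> ?U z" if "z \<in> unit_disk" for z
    using poisson_kernel_nonneg[OF that] by (intro integral_nonneg_AE AE_I2) (simp add: m.space_M)
  assume "\<not> ?h w \<le> ?U w"
  define \<delta> where "\<delta> = ?h w - ?U w"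
  have \<delta>: "0 < \<delta>" using \<open>\<not> _\<close> by (simp add: \<delta>_def)
  then have \<delta>4: "0 < \<delta> / 4" by simp
  from poisson_integral_boundary[OF contT \<delta>4] obtain d1 where d1: "0 < d1"
    "\<And>s z. s \<in> unit_circle \<Longrightarrow> z \<in> unit_disk \<Longrightarrow> cmod (s - z) < d1 \<Longrightarrow> \<bar>?U z - ?h s\<bar> < \<delta> / 4" by metis
  have "uniformly_continuous_on (cball 0 1) ?h"
    by (rule compact_uniformly_continuous[OF conth compact_cball])
  from uniformly_continuous_onE[OF this \<delta>4] obtain d2 where d2: "0 < d2"
    "\<And>s z. s \<in> cball 0 1 \<Longrightarrow> z \<in> cball 0 1 \<Longrightarrow> dist z s < d2 \<Longrightarrow> dist (?h z) (?h s) < \<delta> / 4" by metis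
  define d where "d = min (min d1 d2) 1"
  have d: "0 < d" "d \<le> d1" "d \<le> d2" "d \<le> 1" using d1(1) d2(1) by (auto simp: d_def)
  have near: "?h z - ?U z < \<delta> / 2" if z: "z \<in> unit_disk" "1 - cmod z < d" for z
  proof -
    have "z \<noteq> 0" using z d(4) by auto
    define s where "s = z / of_real (cmod z)"
    have s: "s \<in> unit_circle" using \<open>z \<noteq> 0\<close> by (simp add: s_def norm_divide)
    have "s - z = s * of_real (1 - cmod z)" using \<open>z \<noteq> 0\<close> by (simp add: s_def field_simps)
    then have sz: "cmod (s - z) < d" using s z by (simp add: norm_mult del: of_real_diff)
    have "\<bar>?U z - ?h s\<bar> < \<delta> / 4" using d1(2)[OF s z(1)] sz d by linarith
    moreover have "dist (?h z) (?h s) < \<delta> / 4"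
      using s z sz d by (intro d2(2)) (auto simp: dist_norm norm_minus_commute)
    ultimately show ?thesis unfolding dist_real_def by linarith
  qed
  define \<epsilon> where "\<epsilon> = \<delta> / 2"
  \<comment> \<open>The maximum is sought on a smaller disk, where all functions are continuous.  Within distance
    \<open>d\<close> of the circle the function is below \<open>\<delta>\<close>, so the maximum lies well inside that disk.\<close>
  define R where "R = 1 - d / 2"
  let ?v = "\<lambda>z. ?h z - Re (V z) + \<epsilon> * (cmod z)\<^sup>2"
  have sub: "cball 0 R \<subseteq> unit_disk" using d by (auto simp: R_def)
  have "continuous_on (cball 0 R) ?v"
    by (intro continuous_intros continuous_on_subset[OF conth] 
         continuous_on_subset[OF holomorphic_on_imp_continuous_on[OF V(1)]] sub) (use sub in auto)
  moreover have wR: "w \<in> cball 0 R"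
  proof (rule ccontr)
    assume "w \<notin> cball 0 R"
    then have "1 - cmod w < d" using d by (auto simp: R_def)
    from near[OF w this] \<delta> show False by (simp add: \<delta>_def)
  qed
  ultimately obtain a where a: "a \<in> cball 0 R" "\<And>z. z \<in> cball 0 R \<Longrightarrow> ?v z \<le> ?v a"
    using continuous_attains_sup[OF compact_cball] by blast
  have aD: "a \<in> unit_disk" using a(1) sub by blast
  have "\<delta> \<le> ?v w" using \<delta> by (simp add: \<epsilon>_def \<delta>_def V(2)[OF w])
  also have "\<dots> \<le> ?v a" by (rule a(2)[OF wR])
  also have "\<dots> \<le> ?h a - ?U a + \<epsilon>"
    using aD \<delta> by (simp add: V(2)[OF aD] \<epsilon>_def abs_square_le_1 mult_left_le)
  finally have va: "\<delta> / 2 \<le> ?h a - ?U a" by (simp add: \<epsilon>_def)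
  then have "f a \<noteq> 0" using U_nn[OF aD] \<delta> by auto
  have "cmod a \<le> 1 - d" using near[OF aD] va by force
  then have sub2: "ball a (d / 2) \<subseteq> cball 0 R"
  proof (intro subsetI)
    fix z assume "z \<in> ball a (d / 2)"
    then show "z \<in> cball 0 R" using \<open>cmod a \<le> 1 - d\<close> norm_triangle_sub[of z a]
      by (simp add: R_def dist_norm norm_minus_commute)
  qed
  show False
  proof (rule power_modulus_minus_harmonic_no_strict_max[of f a "d / 2" V \<epsilon> p])
    show "f holomorphic_on ball a (d / 2)" "V holomorphic_on ball a (d / 2)"
      using holomorphic_on_subset[OF hol] holomorphic_on_subset[OF V(1)] sub sub2 by blast+
  qed (use a(2) sub2 \<open>f a \<noteq> 0\<close> d \<delta> in \<open>auto simp: \<epsilon>_def\<close>)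
qed

text \<open>
  For a dilation \<open>f\<^sub>r\<close> of \<open>f\<close>, the power \<open>\<bar>f\<^sub>r\<bar>\<^sup>p\<close> has a harmonic majorant, the Poisson integral of
  its boundary values.  Composed with \<open>\<phi>\<close> it stays harmonic, so its circular means all equal its
  value at \<open>\<phi> 0\<close>, which the means of \<open>f\<close> and the size of the kernel at \<open>\<phi> 0\<close> bound uniformly in \<open>r\<close>.
\<close>
theorem littlewood_subordination:
  assumes p: "0 < p" and \<phi>: "\<phi> holomorphic_on unit_disk" "\<phi> ` unit_disk \<subseteq> unit_disk"
    and f: "f \<in> Hardy p"
  shows "f \<circ> \<phi> \<in> Hardy p"
proof -
  have hol: "f holomorphic_on unit_disk" using f by (simp add: Hardy_def)
  obtain K where K: "\<And>r. 0 < r \<Longrightarrow> r < 1 \<Longrightarrow> (\<integral>t. cmod (f (of_real r * t)) powr p \<partial>circle_lebesgue) \<le> K"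
    using Hardy_means_bounded[OF f] by blast
  define C where "C = 2 / (1 - cmod (\<phi> 0)) * K"
  have \<phi>D: "\<phi> z \<in> unit_disk" if "z \<in> unit_disk" for z using \<phi>(2) that by blast
  have scale: "of_real r * z \<in> unit_disk" if "0 < r" "r < 1" "z \<in> cball 0 1" for r :: real and z :: complex
  proof -
    have "cmod (of_real r * z) \<le> r * 1"
      unfolding norm_mult using that by (auto intro!: mult_mono)
    then show ?thesis using that by simp
  qed
  \<comment> \<open>Dilating \<open>f\<close> by \<open>r\<close> makes it continuous up to the circle, and the radius \<open>s\<close> does the same for
    \<open>\<phi>\<close>; at the end \<open>r\<close> tends to 1 for fixed \<open>s\<close>.\<close>
  have bound: "(\<integral>t. cmod (f (of_real r * \<phi> (of_real s * t))) powr p \<partial>circle_lebesgue) \<le> C"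
    if r: "0 < r" "r < 1" and s: "0 < s" "s < 1" for r s
  proof -
    let ?fr = "\<lambda>z. f (of_real r * z)"
    have fr: "continuous_on (cball 0 1) ?fr" "?fr holomorphic_on unit_disk"
      using scale[OF r]
      by (auto intro!: continuous_on_compose2[OF holomorphic_on_imp_continuous_on[OF hol]] continuous_intros
          holomorphic_on_compose_gen[OF _ hol, unfolded o_def] holomorphic_intros)
    have conth: "continuous_on (cball 0 1) (\<lambda>t. cmod (?fr t) powr p)"
      by (rule continuous_on_powr') (use p in \<open>auto intro!: continuous_intros fr\<close>)
    then have contT: "continuous_on unit_circle (\<lambda>t. cmod (?fr t) powr p)" by (rule continuous_on_subset) auto
    obtain V where V: "V holomorphic_on unit_disk"
      "\<And>z. z \<in> unit_disk \<Longrightarrow> Re (V z) = (\<integral>t. poisson_kernel z t * cmod (?fr t) powr p \<partial>circle_lebesgue)"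
      by (rule schwarz_integral_of_density[OF contT]) auto
    let ?W = "\<lambda>z. V (\<phi> (of_real s * z))"
    have \<phi>s: "continuous_on (cball 0 1) (\<lambda>z. \<phi> (of_real s * z))" "(\<lambda>z. \<phi> (of_real s * z)) holomorphic_on unit_disk"
      using scale[OF s]
      by (auto intro!: continuous_on_compose2[OF holomorphic_on_imp_continuous_on[OF \<phi>(1)]] continuous_intros
          holomorphic_on_compose_gen[OF _ \<phi>(1), unfolded o_def] holomorphic_intros)
    have W: "continuous_on (cball 0 1) ?W" "?W holomorphic_on unit_disk"
      using scale[OF s] \<phi>D
      by (auto intro!: continuous_on_compose2[OF holomorphic_on_imp_continuous_on[OF V(1)] \<phi>s(1)]
          holomorphic_on_compose_gen[OF \<phi>s(2) V(1), unfolded o_def])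
    have WT: "continuous_on unit_circle ?W" by (rule continuous_on_subset[OF W(1)]) auto
    have \<phi>s_le: "\<phi> (of_real s * z) \<in> cball 0 1" if "z \<in> cball 0 1" for z
      using \<phi>D[OF scale[OF s that]] by simp
    have "(\<integral>t. cmod (?fr (\<phi> (of_real s * t))) powr p \<partial>circle_lebesgue) \<le> (\<integral>t. Re (?W t) \<partial>circle_lebesgue)"
    proof (rule integral_mono)
      have "continuous_on unit_circle (\<lambda>t. cmod (?fr (\<phi> (of_real s * t))) powr p)"
        by (rule continuous_on_compose2[OF conth continuous_on_subset[OF \<phi>s(1)]])
          (use \<phi>s_le in auto)
      then show "integrable circle_lebesgue (\<lambda>t. cmod (?fr (\<phi> (of_real s * t))) powr p)"
        by (rule m.integrable_continuous)
      show "integrable circle_lebesgue (\<lambda>t. Re (?W t))"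
        by (intro m.integrable_continuous continuous_intros WT)
      fix t assume "t \<in> space circle_lebesgue"
      then have t: "\<phi> (of_real s * t) \<in> unit_disk" by (intro \<phi>D scale s) (simp add: m.space_M)
      show "cmod (?fr (\<phi> (of_real s * t))) powr p \<le> Re (?W t)"
        unfolding V(2)[OF t] by (rule norm_powr_le_poisson_integral[OF fr p t])
    qed
    also have "\<dots> = Re (\<integral>t. ?W t \<partial>circle_lebesgue)"
      by (rule integral_Re[OF m.integrable_continuous[OF WT]])
    also have "(\<integral>t. ?W t \<partial>circle_lebesgue) = V (\<phi> 0)"
      using mean_value_circle_lebesgue[OF W] by simp
    also have "Re (V (\<phi> 0)) = (\<integral>t. poisson_kernel (\<phi> 0) t * cmod (?fr t) powr p \<partial>circle_lebesgue)"
      by (rule V(2)[OF \<phi>D]) simp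
    also have "\<dots> \<le> (\<integral>t. 2 / (1 - cmod (\<phi> 0)) * cmod (?fr t) powr p \<partial>circle_lebesgue)"
    proof (rule integral_mono)
      show "integrable circle_lebesgue (\<lambda>t. poisson_kernel (\<phi> 0) t * cmod (?fr t) powr p)"
        by (intro m.integrable_continuous continuous_on_mult contT continuous_on_poisson_kernel \<phi>D) simp
      show "integrable circle_lebesgue (\<lambda>t. 2 / (1 - cmod (\<phi> 0)) * cmod (?fr t) powr p)"
        by (intro m.integrable_continuous continuous_on_mult contT continuous_on_const)
      fix t assume "t \<in> space circle_lebesgue"
      then show "poisson_kernel (\<phi> 0) t * cmod (?fr t) powr p \<le> 2 / (1 - cmod (\<phi> 0)) * cmod (?fr t) powr p"
        by (intro mult_right_mono poisson_kernel_le \<phi>D) (simp_all add: m.space_M)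
    qed
    also have "\<dots> \<le> C"
      using K[OF r] \<phi>D[of 0] by (simp add: C_def divide_right_mono)
    finally show ?thesis .
  qed
  have "(\<integral>t. cmod ((f \<circ> \<phi>) (of_real s * t)) powr p \<partial>circle_lebesgue) \<le> C" if s: "0 < s" "s < 1" for s
  proof -
    define r where "r = (\<lambda>n. 1 - 1 / (real n + 2))"
    have r: "0 < r n" "r n < 1" for n by (auto simp: r_def field_simps)
    have r1: "r \<longlonglongrightarrow> 1" unfolding r_def by real_asymp
    have \<phi>T: "continuous_on unit_circle (\<lambda>t. \<phi> (of_real s * t))"
      using scale[OF s]
      by (auto intro!: continuous_on_compose2[OF holomorphic_on_imp_continuous_on[OF \<phi>(1)]] continuous_intros)
    have inD: "\<phi> (of_real s * t) \<in> unit_disk" if "t \<in> unit_circle" for t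
      using scale[OF s, of t] \<phi>D that by auto
    obtain t0 where t0: "t0 \<in> unit_circle"
      "\<And>t. t \<in> unit_circle \<Longrightarrow> cmod (\<phi> (of_real s * t)) \<le> cmod (\<phi> (of_real s * t0))"
      using continuous_attains_sup[OF compact_sphere _ continuous_on_norm[OF \<phi>T]] by (metis norm_one mem_sphere_0 empty_iff)
    define R where "R = cmod (\<phi> (of_real s * t0))"
    have R: "R < 1" using inD[OF t0(1)] by (simp add: R_def)
    have fc: "continuous_on (cball 0 R) (\<lambda>z. cmod (f z) powr p)"
      using R by (intro continuous_on_powr' continuous_intros continuous_on_subset[OF holomorphic_on_imp_continuous_on[OF hol]])
         (use p in auto)
    obtain B where B: "\<And>z. z \<in> cball 0 R \<Longrightarrow> cmod (f z) powr p \<le> B"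
      using continuous_attains_sup[OF compact_cball _ fc] by (metis empty_iff)
    have sm: "of_real (r n) * \<phi> (of_real s * t) \<in> cball 0 R" if "t \<in> unit_circle" for n t
      using t0(2)[OF that] r[of n] mult_mono[of "r n" 1 "cmod (\<phi> (of_real s * t))" R] by (simp add: norm_mult R_def)
    have cn: "continuous_on unit_circle (\<lambda>t. cmod (f (of_real (r n) * \<phi> (of_real s * t))) powr p)" for n
      by (rule continuous_on_compose2[OF fc]) (use sm in \<open>auto intro!: continuous_intros \<phi>T\<close>)
    have c: "continuous_on unit_circle (\<lambda>t. cmod (f (\<phi> (of_real s * t))) powr p)"
      by (rule continuous_on_compose2[OF fc]) (use t0(2) in \<open>auto intro!: continuous_intros \<phi>T simp: R_def\<close>)
    have "(\<lambda>n. \<integral>t. cmod (f (of_real (r n) * \<phi> (of_real s * t))) powr p \<partial>circle_lebesgue)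
      \<longlonglongrightarrow> (\<integral>t. cmod (f (\<phi> (of_real s * t))) powr p \<partial>circle_lebesgue)"
    proof (rule integral_dominated_convergence)
      show "integrable circle_lebesgue (\<lambda>_. B)" by simp
      show "AE t in circle_lebesgue. norm (cmod (f (of_real (r n) * \<phi> (of_real s * t))) powr p) \<le> B" for n
        using B sm by (intro AE_I2) (simp add: m.space_M)
      show "AE t in circle_lebesgue. (\<lambda>n. cmod (f (of_real (r n) * \<phi> (of_real s * t))) powr p)
          \<longlonglongrightarrow> cmod (f (\<phi> (of_real s * t))) powr p"
      proof (rule AE_I2)
        fix t assume "t \<in> space circle_lebesgue"
        then have t: "t \<in> unit_circle" by (simp add: m.space_M)
        have "(\<lambda>n. of_real (r n) * \<phi> (of_real s * t)) \<longlonglongrightarrow> of_real 1 * \<phi> (of_real s * t)"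
          by (intro tendsto_intros r1)
        then show "(\<lambda>n. cmod (f (of_real (r n) * \<phi> (of_real s * t))) powr p)
          \<longlonglongrightarrow> cmod (f (\<phi> (of_real s * t))) powr p"
          using sm[OF t] t0(2)[OF t]
          by (intro continuous_on_tendsto_compose[OF fc] always_eventually) (auto simp: R_def)
      qed
    qed (auto intro!: m.borel_measurable_continuous cn c)
    then show ?thesis
      using bound[OF r s] by (intro LIMSEQ_le_const2) auto
  qed
  moreover have "(f \<circ> \<phi>) holomorphic_on unit_disk"
    by (rule holomorphic_on_compose_gen[OF \<phi>(1) hol \<phi>(2)])
  ultimately show ?thesis unfolding Hardy_def
    by (auto intro!: bdd_aboveI2[where M = C])
qed

lemma Hardy_mult_Hardy_inf:
  assumes p: "0 < p" and q: "q \<in> Hardy_inf" and f: "f \<in> Hardy p"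
  shows "(\<lambda>z. q z * f z) \<in> Hardy p"
proof -
  have hol: "q holomorphic_on unit_disk" "f holomorphic_on unit_disk"
    using q f by (simp_all add: Hardy_inf_def Hardy_def)
  obtain M where M: "0 < M" "\<And>z. z \<in> unit_disk \<Longrightarrow> cmod (q z) \<le> M"
    using q unfolding Hardy_inf_def bounded_pos by blast
  obtain C where C: "\<And>r. 0 < r \<Longrightarrow> r < 1 \<Longrightarrow> (\<integral>t. cmod (f (of_real r * t)) powr p \<partial>circle_lebesgue) \<le> C"
    using Hardy_means_bounded[OF f] by blast
  have "(\<integral>t. cmod (q (of_real r * t) * f (of_real r * t)) powr p \<partial>circle_lebesgue) \<le> M powr p * C"
    if r: "r \<in> {0<..<1}" for r
  proof -
    have disk: "of_real r * t \<in> unit_disk" if "t \<in> unit_circle" for t using that r by (simp add: norm_mult)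
    have cont: "continuous_on unit_circle (\<lambda>t. g (of_real r * t))" if "g holomorphic_on unit_disk" for g
      by (rule continuous_on_compose2[OF holomorphic_on_imp_continuous_on[OF that]])
         (use disk in \<open>auto intro!: continuous_intros\<close>)
    have int: "integrable circle_lebesgue (\<lambda>t. cmod (g (of_real r * t)) powr p)" if "g holomorphic_on unit_disk" for g
      by (intro m.integrable_continuous continuous_on_powr' continuous_on_norm cont[OF that] continuous_on_const)
         (use p in auto)
    have "(\<integral>t. cmod (q (of_real r * t) * f (of_real r * t)) powr p \<partial>circle_lebesgue)
        \<le> (\<integral>t. M powr p * cmod (f (of_real r * t)) powr p \<partial>circle_lebesgue)"
    proof (rule integral_mono)
      show "integrable circle_lebesgue (\<lambda>t. cmod (q (of_real r * t) * f (of_real r * t)) powr p)"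
        by (rule int) (intro holomorphic_intros hol)
      show "integrable circle_lebesgue (\<lambda>t. M powr p * cmod (f (of_real r * t)) powr p)"
        by (intro integrable_mult_right int hol)
      fix t assume "t \<in> space circle_lebesgue"
      then have "cmod (q (of_real r * t)) \<le> M" by (intro M(2) disk) (simp add: m.space_M)
      then show "cmod (q (of_real r * t) * f (of_real r * t)) powr p \<le> M powr p * cmod (f (of_real r * t)) powr p"
        using p by (simp add: norm_mult powr_mult powr_mono2 mult_right_mono)
    qed
    also have "\<dots> \<le> M powr p * C" using C[of r] r by (simp add: mult_left_mono)
    finally show ?thesis .
  qed
  then show ?thesis
    unfolding Hardy_def using hol by (auto intro!: holomorphic_intros bdd_aboveI2[where M = "M powr p * C"])
qed

section \<open>The inclusion criterion\<close>

theorem theorem4p5: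
  fixes p :: real and \<phi> :: "complex \<Rightarrow> complex"
    and \<alpha>\<^sub>1 \<alpha>\<^sub>2 :: complex and \<mu>\<^sub>1 \<mu>\<^sub>2 :: "complex measure"
  assumes "0 < p"
    and "\<phi> holomorphic_on unit_disk" and "\<phi> ` unit_disk \<subseteq> unit_disk"
    and "cmod \<alpha>\<^sub>1 = 1" and "singular_circle_measure \<mu>\<^sub>1"
    and "cmod \<alpha>\<^sub>2 = 1" and "singular_circle_measure \<mu>\<^sub>2"
  shows "composition_op \<phi> ` mult_Hardy (singular_fun \<alpha>\<^sub>1 \<mu>\<^sub>1) p \<subseteq> mult_Hardy (singular_fun \<alpha>\<^sub>2 \<mu>\<^sub>2) p
    \<longleftrightarrow> Hinf_divides (singular_fun \<alpha>\<^sub>2 \<mu>\<^sub>2) (singular_part (singular_fun \<alpha>\<^sub>1 \<mu>\<^sub>1 \<circ> \<phi>))"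
proof -
  note p = assms(1) and \<phi> = assms(2,3)
  define S\<^sub>1 where "S\<^sub>1 = singular_fun \<alpha>\<^sub>1 \<mu>\<^sub>1"
  define S\<^sub>2 where "S\<^sub>2 = singular_fun \<alpha>\<^sub>2 \<mu>\<^sub>2"
  define F where "F = S\<^sub>1 \<circ> \<phi>"
  define S where "S = singular_part F"
  note \<mu>\<^sub>1 = singular_circle_measureD[OF assms(5)] and \<mu>\<^sub>2 = singular_circle_measureD[OF assms(7)]
  interpret \<mu>\<^sub>1: circle_measure \<mu>\<^sub>1 by (rule \<mu>\<^sub>1)
  have \<phi>D: "\<phi> z \<in> unit_disk" if "z \<in> unit_disk" for z using \<phi>(2) that by blast
  have S\<^sub>2: "S\<^sub>2 holomorphic_on unit_disk" "\<And>z. S\<^sub>2 z \<noteq> 0"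
    "\<And>z. z \<in> unit_disk \<Longrightarrow> cmod (S\<^sub>2 z) = exp (- (\<integral>t. poisson_kernel z t \<partial>\<mu>\<^sub>2))"
    unfolding S\<^sub>2_def using holomorphic_singular_fun[OF \<mu>\<^sub>2] singular_fun_nonzero[OF assms(6)]
      cmod_singular_fun[OF assms(6) \<mu>\<^sub>2] by auto
  have Fhol: "F holomorphic_on unit_disk"
    unfolding F_def S\<^sub>1_def by (rule holomorphic_on_compose_gen[OF \<phi>(1) holomorphic_singular_fun[OF \<mu>\<^sub>1] \<phi>(2)])
  have Fnz: "F z \<noteq> 0" for z
    using singular_fun_nonzero[OF assms(4)] by (simp add: F_def S\<^sub>1_def)
  have P1: "0 \<le> (\<integral>t. poisson_kernel (\<phi> z) t \<partial>\<mu>\<^sub>1)" if "z \<in> unit_disk" for z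
    using poisson_kernel_nonneg[OF \<phi>D[OF that]] by (intro integral_nonneg_AE AE_I2) (simp add: \<mu>\<^sub>1.space_M)
  have F1: "cmod (F z) \<le> 1" if "z \<in> unit_disk" for z
    using cmod_singular_fun[OF assms(4) \<mu>\<^sub>1 \<phi>D[OF that]] P1[OF that] by (simp add: F_def S\<^sub>1_def)
  have "\<exists>S. is_singular_part F S"
  proof (rule singular_part_exists[OF _ _ assms(4)])
    let ?H = "(\<lambda>z. \<integral>t. (t + z) / (t - z) \<partial>\<mu>\<^sub>1) \<circ> \<phi>"
    show "?H holomorphic_on unit_disk"
      by (rule holomorphic_on_compose_gen[OF \<phi>(1) \<mu>\<^sub>1.holomorphic_schwarz_integral \<phi>(2)])
    show "0 \<le> Re (?H z)" if "z \<in> unit_disk" for z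
      using P1[OF that] \<mu>\<^sub>1.Re_schwarz_integral[OF \<phi>D[OF that]] by simp
    show "F z = \<alpha>\<^sub>1 * exp (- ?H z)" for z by (simp add: F_def S\<^sub>1_def singular_fun_def)
  qed
  then have "is_singular_part F S"
    unfolding S_def singular_part_def by (rule someI_ex)
  from nonvanishing_factorization[OF this Fnz] obtain \<alpha> \<sigma> u where
    \<alpha>: "cmod \<alpha> = 1" and \<sigma>: "singular_circle_measure \<sigma>" and u: "integrable circle_lebesgue (u :: complex \<Rightarrow> real)"
    and S: "\<And>z. z \<in> unit_disk \<Longrightarrow> S z = singular_fun \<alpha> \<sigma> z"
    and FS: "\<And>z. z \<in> unit_disk \<Longrightarrow> cmod (F z) = cmod (S z) * exp (\<integral>t. poisson_kernel z t * u t \<partial>circle_lebesgue)"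
    by blast
  note \<sigma>' = singular_circle_measureD[OF \<sigma>]
  have cmodS: "cmod (S z) = exp (- (\<integral>t. poisson_kernel z t \<partial>\<sigma>))" if "z \<in> unit_disk" for z
    using cmod_singular_fun[OF \<alpha> \<sigma>' that] S[OF that] by simp
  have Shol: "S holomorphic_on unit_disk"
    by (rule holomorphic_transform[OF holomorphic_singular_fun[OF \<sigma>', of \<alpha>]]) (simp add: S)
  have u0: "AE t in circle_lebesgue. u t \<le> 0"
  proof (rule outer_exponent_nonpos[OF \<sigma> u])
    fix z assume z: "z \<in> unit_disk"
    have "exp ((\<integral>t. poisson_kernel z t * u t \<partial>circle_lebesgue) - (\<integral>t. poisson_kernel z t \<partial>\<sigma>)) \<le> 1"
      using F1[OF z] unfolding FS[OF z] cmodS[OF z] exp_add[symmetric] by simp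
    then show "(\<integral>t. poisson_kernel z t * u t \<partial>circle_lebesgue) \<le> (\<integral>t. poisson_kernel z t \<partial>\<sigma>)" by simp
  qed
  have F_le_S: "cmod (F z) \<le> cmod (S z)" if z: "z \<in> unit_disk" for z
  proof -
    have "0 \<le> (\<integral>t. - (poisson_kernel z t * u t) \<partial>circle_lebesgue)"
    proof (rule integral_nonneg_AE)
      show "AE t in circle_lebesgue. 0 \<le> - (poisson_kernel z t * u t)"
        using u0 AE_space
        by eventually_elim (use poisson_kernel_nonneg[OF z] in \<open>auto simp: m.space_M mult_nonneg_nonpos\<close>)
    qed
    then show ?thesis unfolding FS[OF z] by (simp add: mult_left_le)
  qed
  have "composition_op \<phi> ` mult_Hardy S\<^sub>1 p \<subseteq> mult_Hardy S\<^sub>2 p \<longleftrightarrow> Hinf_divides S\<^sub>2 S"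
  proof
    assume L: "composition_op \<phi> ` mult_Hardy S\<^sub>1 p \<subseteq> mult_Hardy S\<^sub>2 p"
    \<comment> \<open>Testing the inclusion on \<open>S\<^sub>1\<close> itself already gives everything.\<close>
    have "(\<lambda>_. 1) \<in> Hardy p" by (auto simp: Hardy_def m.prob_space intro!: bdd_aboveI2[where M = 1])
    then have "S\<^sub>1 \<in> mult_Hardy S\<^sub>1 p" unfolding mult_Hardy_def by force
    then have "F \<in> mult_Hardy S\<^sub>2 p" using L by (auto simp: composition_op_def F_def)
    then obtain f where f: "f \<in> Hardy p" "\<And>z. z \<in> unit_disk \<Longrightarrow> F z = S\<^sub>2 z * f z"
      unfolding mult_Hardy_def by blast
    have fnz: "f z \<noteq> 0" if "z \<in> unit_disk" for z using f(2)[OF that] Fnz[of z] by auto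
    have "emeasure \<mu>\<^sub>2 E \<le> emeasure \<sigma> E" for E
    proof (rule singular_measure_le_of_Hardy_quotient[OF p assms(7) \<sigma> _ f(1) fnz])
      show "integrable circle_lebesgue (\<lambda>t. - u t)" using u by simp
      fix z assume z: "z \<in> unit_disk"
      have "ln (cmod (F z)) = ln (cmod (S\<^sub>2 z)) + ln (cmod (f z))"
        using f(2)[OF z] fnz[OF z] S\<^sub>2(2)[of z] by (simp add: norm_mult ln_mult)
      moreover have "ln (cmod (F z)) = - (\<integral>t. poisson_kernel z t \<partial>\<sigma>) + (\<integral>t. poisson_kernel z t * u t \<partial>circle_lebesgue)"
        unfolding FS[OF z] cmodS[OF z] exp_add[symmetric] by (rule ln_exp)
      ultimately show "(\<integral>t. poisson_kernel z t \<partial>\<mu>\<^sub>2) = (\<integral>t. poisson_kernel z t \<partial>\<sigma>)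
          + (\<integral>t. poisson_kernel z t * - u t \<partial>circle_lebesgue) + ln (cmod (f z))"
        using S\<^sub>2(3)[OF z] by simp
    qed
    from poisson_integral_mono_measure[OF \<mu>\<^sub>2 \<sigma>' this]
    have "cmod (S z) \<le> cmod (S\<^sub>2 z)" if "z \<in> unit_disk" for z
      using that cmodS S\<^sub>2(3) by simp
    then have "(\<lambda>z. S z / S\<^sub>2 z) \<in> Hardy_inf"
      unfolding Hardy_inf_def using S\<^sub>2
      by (auto intro!: holomorphic_intros Shol boundedI[where B = 1] simp: norm_divide)
    then show "Hinf_divides S\<^sub>2 S"
      unfolding Hinf_divides_def using S\<^sub>2(2) by (intro bexI[of _ "\<lambda>z. S z / S\<^sub>2 z"]) auto
  next
    assume "Hinf_divides S\<^sub>2 S"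
    then obtain h where h: "h \<in> Hardy_inf" "\<And>z. z \<in> unit_disk \<Longrightarrow> S z = S\<^sub>2 z * h z"
      unfolding Hinf_divides_def by blast
    obtain M where M: "\<And>z. z \<in> unit_disk \<Longrightarrow> cmod (h z) \<le> M"
      using h(1) unfolding Hardy_inf_def bounded_iff by blast
    \<comment> \<open>Bounded because \<open>\<bar>F\<bar> \<le> \<bar>S\<bar>\<close>; it collects the outer factor of \<open>F\<close> and the quotient \<open>h\<close>.\<close>
    define q where "q z = F z / S\<^sub>2 z" for z
    have "cmod (q z) \<le> M" if z: "z \<in> unit_disk" for z
    proof -
      have "cmod (q z) \<le> cmod (S z) / cmod (S\<^sub>2 z)"
        unfolding q_def norm_divide using F_le_S[OF z] by (simp add: divide_right_mono)
      also have "\<dots> = cmod (h z)" using h(2)[OF z] S\<^sub>2(2)[of z] by (simp add: norm_mult)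
      finally show ?thesis using M[OF z] by simp
    qed
    then have q: "q \<in> Hardy_inf"
      unfolding Hardy_inf_def using S\<^sub>2
      by (auto intro!: holomorphic_intros Fhol boundedI[where B = M] simp: q_def[abs_def])
    show "composition_op \<phi> ` mult_Hardy S\<^sub>1 p \<subseteq> mult_Hardy S\<^sub>2 p"
    proof safe
      fix G assume "G \<in> mult_Hardy S\<^sub>1 p"
      then obtain f where f: "f \<in> Hardy p" "\<And>z. z \<in> unit_disk \<Longrightarrow> G z = S\<^sub>1 z * f z"
        unfolding mult_Hardy_def by blast
      have "(\<lambda>z. q z * (f \<circ> \<phi>) z) \<in> Hardy p"
        by (rule Hardy_mult_Hardy_inf[OF p q littlewood_subordination[OF p \<phi> f(1)]])
      moreover have "composition_op \<phi> G z = S\<^sub>2 z * (q z * (f \<circ> \<phi>) z)" if "z \<in> unit_disk" for z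
        using f(2)[OF \<phi>D[OF that]] S\<^sub>2(2)[of z] by (simp add: composition_op_def q_def F_def)
      ultimately show "composition_op \<phi> G \<in> mult_Hardy S\<^sub>2 p"
        unfolding mult_Hardy_def mem_Collect_eq by (intro bexI[of _ "\<lambda>z. q z * (f \<circ> \<phi>) z"] ballI)
    qed
  qed
  then show ?thesis unfolding S_def F_def S\<^sub>1_def S\<^sub>2_def .
qed

end
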